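(* If an edge ordering $f$ of $K_n$ is chosen uniformly at random from all bijections $E(K_n)\to\{1,2,\dots,\binom n2\}$, then an $f$-increasing Hamiltonian path exists in $K_n$ with probability at least $\frac1e+o(1)$ as $n\to\infty$.
   Context: An edge ordering of $K_n$ is a bijection $f:E(K_n)\to\{1,2,\dots,\binom n2\}$; $f(e)$ is the label of $e$. An $f$-increasing path is a simple path along which the label of each edge is greater than the label of the previous edge. It is Hamiltonian if it visits all $n$ vertices. *)

theory Defs
  imports "HOL-Probability.Probability" "HOL-Library.Landau_Symbols"
begin

text \<open>The complete graph on the vertices \<open>1, \<dots>, n\<close>; edges are two-element sets of vertices.\<close>

definition verts :: "nat \<Rightarrow> nat set" where
  "verts n = {1..n}"

definition edges :: "nat \<Rightarrow> nat set set" where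
  "edges n = {e. e \<subseteq> verts n \<and> card e = 2}"

text \<open>Orderings are total functions; extensionality pins their values outside the edge set, so
  that distinct elements below are distinct bijections on the edges.\<close>

definition edge_orderings :: "nat \<Rightarrow> (nat set \<Rightarrow> nat) set" where
  "edge_orderings n = {f \<in> extensional (edges n). bij_betw f (edges n) {1..n choose 2}}"

text \<open>A simple path is given by its nonempty list of pairwise distinct vertices, in order of
  traversal.\<close>

definition simple_path :: "nat \<Rightarrow> nat list \<Rightarrow> bool" where
  "simple_path n p \<longleftrightarrow> p \<noteq> [] \<and> distinct p \<and> set p \<subseteq> verts n"

definition path_edges :: "nat list \<Rightarrow> nat set list" where
  "path_edges p = map2 (\<lambda>u v. {u, v}) p (tl p)"

definition increasing_path :: "nat \<Rightarrow> (nat set \<Rightarrow> nat) \<Rightarrow> nat list \<Rightarrow> bool" where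
  "increasing_path n f p \<longleftrightarrow> simple_path n p \<and> successively (<) (map f (path_edges p))"

definition hamiltonian :: "nat \<Rightarrow> nat list \<Rightarrow> bool" where
  "hamiltonian n p \<longleftrightarrow> set p = verts n"

definition random_edge_ordering :: "nat \<Rightarrow> (nat set \<Rightarrow> nat) pmf" where
  "random_edge_ordering n = pmf_of_set (edge_orderings n)"

text \<open>\<^const>\<open>pmf_of_set\<close> is the uniform distribution only on finite nonempty sets, which the
  following facts establish.\<close>

lemma finite_edges: "finite (edges n)"
  unfolding edges_def verts_def by (rule finite_subset[of _ "Pow {1..n}"]) auto

lemma card_edges: "card (edges n) = n choose 2"
  unfolding edges_def verts_def using n_subsets[of "{1..n}" 2] by simp

lemma finite_edge_orderings: "finite (edge_orderings n)"
proof (rule finite_subset)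
  show "edge_orderings n \<subseteq> edges n \<rightarrow>\<^sub>E {1..n choose 2}"
    by (auto simp: edge_orderings_def PiE_def bij_betw_def)
  show "finite (edges n \<rightarrow>\<^sub>E {1..n choose 2})"
    by (intro finite_PiE finite_edges) simp
qed

lemma edge_orderings_nonempty: "edge_orderings n \<noteq> {}"
proof -
  obtain h where "bij_betw h (edges n) {1..n choose 2}"
    using finite_same_card_bij[OF finite_edges, of "{1..n choose 2}" n] card_edges by auto
  then have "bij_betw (restrict h (edges n)) (edges n) {1..n choose 2}"
    by (simp add: bij_betw_restrict_eq)
  then have "restrict h (edges n) \<in> edge_orderings n"
    by (simp add: edge_orderings_def)
  then show ?thesis by blast
qed

end

theory Submission
  imports Defs "HOL-Real_Asymp.Real_Asymp"
begin

text \<open>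
  The proof is the second moment method. Let \<open>X\<close> be the number of increasing Hamiltonian paths,
  counted with a direction; each of the \<open>n!\<close> directed paths is increasing with probability
  \<open>1 / (n - 1)!\<close>, so \<open>E X = n\<close>, and it remains to show \<open>E X\<^sup>2 \<le> (e + o(1)) n\<^sup>2\<close>. If the paths \<open>P\<close>
  and \<open>Q\<close> are both increasing, their edges merge into one increasing sequence, which is described by a
  word over four letters: an edge of \<open>P\<close> only, an edge of \<open>Q\<close> only, or a shared edge traversed by \<open>Q\<close>
  in the same or in the reverse direction as by \<open>P\<close>. A word of length \<open>L\<close> contributes \<open>1 / L!\<close>.

  Suppose that a word has \<open>k\<close> shared letters, forming \<open>r\<close> maximal runs. A reverse letter has to be a run of
  its own, and the word fixes \<open>Q\<close>, relative to \<open>P\<close>, on \<open>k + r\<close> vertices. On the other vertices \<open>Q\<close> is a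
  bijection that creates no further shared edge, which asymptotically is a fraction \<open>exp (- 2)\<close> of all
  bijections. Normalised by \<open>n\<^sup>2\<close>, an isolated shared edge has weight \<open>2\<close> (two directions) and a run
  of length \<open>l \<ge> 2\<close> has weight \<open>2 powr (1 - l)\<close>, so runs have total weight \<open>3\<close> and \<open>E X\<^sup>2 / n\<^sup>2\<close> tends
  to \<open>exp (- 2) * (\<Sum>r. 3 ^ r / fact r) = exp 1\<close>.
\<close>

section \<open>Bijections without bonds\<close>

text \<open>The factor \<open>exp (- 2)\<close> is what brings the constant down to e: bounding the
  free part of Q by all bijections would give exp 3. For this factor, lower bounds on a (k + 1) / a
  k are enough: they make the sum of all a k at least about exp 2 * a 0, while that sum is at most
  M!. The obstacle is uniformity. The fraction \<open>exp (- 2)\<close> is reached only for fixed k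
  as the number of free positions grows. The sum over k is therefore cut at a constant K. Below K
  the fraction is used; from K on, the free part is bounded by a full factorial, which costs a
  constant factor on a tail that is small anyway. The tail needs two estimates. As long as n - k
  exceeds n / 8, every shared edge costs a constant factor below 1. Closer to k = n this fails,
  because P and Q almost coincide: the diagonal P = Q alone contributes E X = n, that is 1 / n after
  normalisation. The terms near the diagonal are shown to be O(1 / n) in total. All counts of words
  and pairs are upper bounds, so union bounds and overcounting are harmless. Cauchy-Schwarz then
  turns the moment bound into a probability.\<close>

definition bijections :: "'a set \<Rightarrow> 'b set \<Rightarrow> ('a \<Rightarrow> 'b) set" where
  "bijections V W = {\<sigma> \<in> extensional V. bij_betw \<sigma> V W}"

definition adjacent :: "nat \<Rightarrow> nat \<Rightarrow> bool" where
  "adjacent a b \<longleftrightarrow> a = Suc b \<or> b = Suc a"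

text \<open>Distance at most \<open>d\<close>, written with additions because subtraction on
  naturals truncates.\<close>

definition near :: "nat \<Rightarrow> nat \<Rightarrow> nat \<Rightarrow> bool" where
  "near d a b \<longleftrightarrow> a \<le> b + d \<and> b \<le> a + d"

text \<open>If Q visits the vertices of P in the order \<sigma>, a bond is an edge of Q that is also
  an edge of P, in either direction; it is recorded by its left position.\<close>

definition bonds :: "nat set \<Rightarrow> (nat \<Rightarrow> nat) \<Rightarrow> nat set" where
  "bonds V \<sigma> = {t \<in> V. Suc t \<in> V \<and> adjacent (\<sigma> t) (\<sigma> (Suc t))}"

text \<open>A switch moves two adjacent values \<open>\<sigma> s\<close> and \<open>\<sigma> s'\<close> to the positions \<open>t\<close> and \<open>Suc t\<close>. There are
  about \<open>2 M\<^sup>2\<close> switches of a bijection between sets of size \<open>M\<close>, nearly all of them create one bond and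
  change no other, and a bijection with \<open>k + 1\<close> bonds arises from at most \<open>(k + 1) M\<^sup>2\<close> of them.
  So the number \<open>a k\<close> of bijections with \<open>k\<close> bonds satisfies \<open>(k + 1) a (k + 1) \<ge> (2 - o(1)) a k\<close>.\<close>

definition switch :: "nat \<times> nat \<times> nat \<Rightarrow> (nat \<Rightarrow> nat) \<Rightarrow> nat \<Rightarrow> nat" where
  "switch = (\<lambda>(t, s, s') \<sigma>. \<sigma> \<circ> Transposition.transpose t s \<circ> Transposition.transpose (Suc t) s')"

definition switches :: "nat set \<Rightarrow> (nat \<Rightarrow> nat) \<Rightarrow> (nat \<times> nat \<times> nat) set" where
  "switches V \<sigma> = {(t, s, s'). t \<in> V \<and> Suc t \<in> V \<and> s \<in> V \<and> s' \<in> V \<and> adjacent (\<sigma> s) (\<sigma> s')}"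

definition good_switches :: "nat set \<Rightarrow> (nat \<Rightarrow> nat) \<Rightarrow> (nat \<times> nat \<times> nat) set" where
  "good_switches V \<sigma> =
    {x \<in> switches V \<sigma>. fst x \<notin> bonds V \<sigma> \<and> bonds V (switch x \<sigma>) = insert (fst x) (bonds V \<sigma>)}"

lemma finite_bijections: "finite V \<Longrightarrow> finite W \<Longrightarrow> finite (bijections V W)"
  by (rule finite_subset[of _ "V \<rightarrow>\<^sub>E W"])
    (auto simp: bijections_def PiE_def bij_betw_def intro: finite_PiE[unfolded PiE_def])

lemma switch_bijections:
  assumes "\<sigma> \<in> bijections V W" "t \<in> V" "Suc t \<in> V" "s \<in> V" "s' \<in> V"
  shows "switch (t, s, s') \<sigma> \<in> bijections V W"
proof -
  have tr: "bij_betw (Transposition.transpose a b) V V" if "a \<in> V" "b \<in> V" for a b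
    using that by (intro bij_betw_byWitness[where f' = "Transposition.transpose a b"])
      (auto simp: Transposition.transpose_def split: if_splits)
  have "bij_betw (switch (t, s, s') \<sigma>) V W"
    unfolding switch_def prod.case
    by (intro bij_betw_trans[OF tr bij_betw_trans[OF tr]] assms)
      (use assms in \<open>auto simp: bijections_def\<close>)
  moreover have "switch (t, s, s') \<sigma> \<in> extensional V"
    using assms by (auto simp: switch_def extensional_def bijections_def Transposition.transpose_def)
  ultimately show ?thesis by (simp add: bijections_def)
qed

lemma inj_switch: "inj (switch x)"
proof (rule injI)
  fix \<sigma> \<rho> assume eq: "switch x \<sigma> = switch x \<rho>"
  obtain t s s' where x: "x = (t, s, s')" by (cases x)
  have "switch x \<pi> \<circ> Transposition.transpose (Suc t) s' \<circ> Transposition.transpose t s = \<pi>" for \<pi>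
    by (auto simp: switch_def x fun_eq_iff)
  with eq show "\<sigma> = \<rho>" by metis
qed

text \<open>Only pairs that meet \<open>t\<close>, \<open>Suc t\<close>, \<open>s\<close> or
  \<open>s'\<close> can change. Condition \<open>1\<close> keeps old bonds away from them, so none
  is lost. Condition \<open>2\<close> stops the values moved to \<open>t\<close> and
  \<open>Suc t\<close> from bonding with the outer neighbours, and \<open>3\<close> does this for
  the values moved to \<open>s\<close> and \<open>s'\<close>. Radius 2 covers both outer neighbours
  t - 1 and t + 2, and all values adjacent to \<open>\<sigma> s\<close> or
  \<open>\<sigma> s'\<close>.\<close>

lemma good_switchI:
  assumes bij: "bij_betw \<sigma> V W" and x: "(t, s, s') \<in> switches V \<sigma>"
    and Z: "Z = bonds V \<sigma> \<union> Suc ` bonds V \<sigma>"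
    and 1: "t \<notin> Z" "Suc t \<notin> Z" "s \<notin> Z" "s' \<notin> Z"
    and 2: "\<And>a. a \<in> V \<Longrightarrow> near 2 a t \<Longrightarrow> \<not> near 2 (\<sigma> a) (\<sigma> s)"
    and 3: "\<And>b x y. b \<in> V \<Longrightarrow> x \<in> {t, Suc t} \<Longrightarrow> y \<in> {s, s'} \<Longrightarrow> near 1 b y \<Longrightarrow> \<not> near 1 (\<sigma> b) (\<sigma> x)"
  shows "(t, s, s') \<in> good_switches V \<sigma>"
proof -
  define \<rho> where "\<rho> = switch (t, s, s') \<sigma>"
  have V: "t \<in> V" "Suc t \<in> V" "s \<in> V" "s' \<in> V" and adj: "adjacent (\<sigma> s) (\<sigma> s')"
    using x by (auto simp: switches_def)
  have adj_near: "near 1 a b" if "adjacent a b" for a b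
    using that by (auto simp: adjacent_def near_def)
  have near_mono: "near d a b \<Longrightarrow> d \<le> e \<Longrightarrow> near e a b" for d e a b
    by (auto simp: near_def)
  \<comment> \<open>A position \<open>s\<close> near \<open>t\<close> would violate \<open>2\<close>
    with value distance 0, and \<open>s'\<close> with distance 1. So the two transpositions act on
    disjoint pairs.\<close>
  have far: "\<not> near 2 s t" "\<not> near 2 s' t"
    using 2[OF V(3)] 2[OF V(4)] adj by (auto simp: near_def adjacent_def)
  have ss: "s \<noteq> s'" using adj by (auto simp: adjacent_def)
  have dist: "t \<noteq> s" "t \<noteq> s'" "Suc t \<noteq> s" "Suc t \<noteq> s'" using far by (auto simp: near_def)
  have val: "\<rho> t = \<sigma> s" "\<rho> (Suc t) = \<sigma> s'" "\<rho> s = \<sigma> t" "\<rho> s' = \<sigma> (Suc t)"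
    "\<And>z. z \<notin> {t, Suc t, s, s'} \<Longrightarrow> \<rho> z = \<sigma> z"
    using dist ss by (auto simp: \<rho>_def switch_def Transposition.transpose_def)
  have tb: "t \<notin> bonds V \<sigma>" using 1 Z by auto
  then have nadj: "\<not> adjacent (\<sigma> t) (\<sigma> (Suc t))" using V by (auto simp: bonds_def)
  have sym: "adjacent a b = adjacent b a" for a b by (auto simp: adjacent_def)
  have new: "\<not> adjacent (\<rho> a) (\<rho> b)"
    if ab: "adjacent a b" "b \<in> V" "a \<in> {t, Suc t, s, s'}" "{a, b} \<noteq> {t, Suc t}" for a b
  proof -
    from ab(3) consider "a = t" | "a = Suc t" | "a = s" | "a = s'" by auto
    then show ?thesis
    proof cases
      case 1
      then have b: "near 2 b t" "b \<noteq> t" "b \<noteq> Suc t" using ab by (auto simp: near_def adjacent_def)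
      then have "\<rho> b = \<sigma> b" using far val(5)[of b] by auto
      with 2[OF ab(2) b(1)] show ?thesis using 1 val by (auto simp: adjacent_def near_def)
    next
      case 2
      then have b: "near 2 b t" "b \<noteq> t" "b \<noteq> Suc t" using ab by (auto simp: near_def adjacent_def)
      then have "\<rho> b = \<sigma> b" using far val(5)[of b] by auto
      with assms(8)[OF ab(2) b(1)] show ?thesis using 2 val adj by (auto simp: adjacent_def near_def)
    next
      case 3
      then have b: "near 1 b s" "b \<noteq> s" using ab by (auto simp: near_def adjacent_def)
      then have "b \<noteq> t" "b \<noteq> Suc t" using far by (auto simp: near_def)
      \<comment> \<open>If \<open>s\<close> and \<open>s'\<close> are neighbours, they now carry the
        values of \<open>t\<close> and \<open>Suc t\<close>, which are not adjacent because
        \<open>t\<close> was no bond.\<close>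
      moreover have ?thesis if "b = s'" using 3 that val nadj by simp
      moreover have "\<not> adjacent (\<sigma> t) (\<sigma> b)"
        using assms(9)[OF ab(2), of t s] b adj_near[of "\<sigma> b" "\<sigma> t"] by (auto simp: sym)
      ultimately show ?thesis using 3 val b by (cases "b = s'") auto
    next
      case 4
      then have b: "near 1 b s'" "b \<noteq> s'" using ab by (auto simp: near_def adjacent_def)
      then have "b \<noteq> t" "b \<noteq> Suc t" using far by (auto simp: near_def)
      moreover have ?thesis if "b = s" using 4 that val nadj by (simp add: sym)
      moreover have "\<not> adjacent (\<sigma> (Suc t)) (\<sigma> b)"
        using assms(9)[OF ab(2), of "Suc t" s'] b adj_near[of "\<sigma> b" "\<sigma> (Suc t)"] by (auto simp: sym)
      ultimately show ?thesis using 4 val b by (cases "b = s") auto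
    qed
  qed
  have "z \<in> bonds V \<rho> \<longleftrightarrow> z \<in> insert t (bonds V \<sigma>)" for z
  proof (cases "z = t")
    case True
    then show ?thesis using V val adj by (simp add: bonds_def)
  next
    case False
    show ?thesis
    proof (cases "{z, Suc z} \<inter> {t, Suc t, s, s'} = {}")
      case True
      then have "\<rho> z = \<sigma> z" "\<rho> (Suc z) = \<sigma> (Suc z)" by (auto intro!: val(5))
      then show ?thesis using False by (auto simp: bonds_def)
    next
      case touch: False
      have "z \<notin> bonds V \<sigma>" using touch 1 Z by auto
      moreover have "z \<notin> bonds V \<rho>"
      proof
        assume "z \<in> bonds V \<rho>"
        then have z: "z \<in> V" "Suc z \<in> V" "adjacent (\<rho> z) (\<rho> (Suc z))" by (auto simp: bonds_def)
        have "{z, Suc z} \<noteq> {t, Suc t}" "{Suc z, z} \<noteq> {t, Suc t}" using False by (auto simp: doubleton_eq_iff)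
        then show False
          using new[of z "Suc z"] new[of "Suc z" z] z touch
          by (auto simp: adjacent_def)
      qed
      ultimately show ?thesis using False by simp
    qed
  qed
  then have "bonds V \<rho> = insert t (bonds V \<sigma>)" by blast
  then show ?thesis using x tb by (simp add: good_switches_def \<rho>_def)
qed

lemma card_near: "card {x \<in> V. near d x c} \<le> 2 * d + 1"
proof -
  have "card {x \<in> V. near d x c} \<le> card {c - d..c + d}"
    by (rule card_mono) (auto simp: near_def)
  then show ?thesis by auto
qed

lemma card_near_image:
  assumes "inj_on \<sigma> V"
  shows "card {x \<in> V. near d (\<sigma> x) c} \<le> 2 * d + 1"
proof -
  have "card {x \<in> V. near d (\<sigma> x) c} \<le> card {c - d..c + d}"
    using assms by (intro card_inj_on_le[of \<sigma>]) (auto simp: near_def inj_on_def)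
  then show ?thesis by auto
qed

lemma card_adjacent_image:
  assumes "inj_on \<sigma> V"
  shows "card {x \<in> V. adjacent c (\<sigma> x)} \<le> 2"
proof -
  have "card {x \<in> V. adjacent c (\<sigma> x)} \<le> card {c - 1, Suc c}"
    using assms by (intro card_inj_on_le[of \<sigma>]) (auto simp: adjacent_def inj_on_def)
  also have "\<dots> \<le> 2" by (simp add: card_insert_if)
  finally show ?thesis .
qed

lemma card_UN_le_mult:
  assumes "finite A" "card A \<le> a" "\<And>x. x \<in> A \<Longrightarrow> card (f x) \<le> b"
  shows "card (\<Union>x\<in>A. f x) \<le> a * b"
proof -
  have "card (\<Union>x\<in>A. f x) \<le> (\<Sum>x\<in>A. card (f x))" by (rule card_UN_le[OF assms(1)])
  also have "\<dots> \<le> card A * b" using assms(3) sum_bounded_above[of A "\<lambda>x. card (f x)" b] by simp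
  also have "\<dots> \<le> a * b" using assms(2) by simp
  finally show ?thesis .
qed

text \<open>Once \<open>t\<close> and the position restricted by \<open>P\<close> are chosen, the
  other position must carry one of at most two adjacent values; hence the factor 2.\<close>

lemma card_switches_restricted:
  assumes V: "finite V" and inj: "inj_on \<sigma> V" and T: "finite T" "card T \<le> m"
    and Y: "\<And>t. t \<in> T \<Longrightarrow> card {y \<in> V. P t y} \<le> c"
  shows "card {(t, s, s'). t \<in> T \<and> s \<in> V \<and> s' \<in> V \<and> adjacent (\<sigma> s) (\<sigma> s') \<and> P t s} \<le> m * (c * 2)"
    and "card {(t, s, s'). t \<in> T \<and> s \<in> V \<and> s' \<in> V \<and> adjacent (\<sigma> s) (\<sigma> s') \<and> P t s'} \<le> m * (c * 2)"
proof -
  have "{(t, s, s'). t \<in> T \<and> s \<in> V \<and> s' \<in> V \<and> adjacent (\<sigma> s) (\<sigma> s') \<and> P t s} =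
    (\<Union>t\<in>T. \<Union>s\<in>{y \<in> V. P t y}. (\<lambda>s'. (t, s, s')) ` {x \<in> V. adjacent (\<sigma> s) (\<sigma> x)})"
    by auto
  also have "card \<dots> \<le> m * (c * 2)"
    using V T Y
    by (intro card_UN_le_mult order.trans[OF card_image_le card_adjacent_image[OF inj]]) auto
  finally show "card {(t, s, s'). t \<in> T \<and> s \<in> V \<and> s' \<in> V \<and> adjacent (\<sigma> s) (\<sigma> s') \<and> P t s} \<le> m * (c * 2)" .
  have "{(t, s, s'). t \<in> T \<and> s \<in> V \<and> s' \<in> V \<and> adjacent (\<sigma> s) (\<sigma> s') \<and> P t s'} =
    (\<Union>t\<in>T. \<Union>s'\<in>{y \<in> V. P t y}. (\<lambda>s. (t, s, s')) ` {x \<in> V. adjacent (\<sigma> s') (\<sigma> x)})"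
    by (auto simp: adjacent_def)
  also have "card \<dots> \<le> m * (c * 2)"
    using V T Y
    by (intro card_UN_le_mult order.trans[OF card_image_le card_adjacent_image[OF inj]]) auto
  finally show "card {(t, s, s'). t \<in> T \<and> s \<in> V \<and> s' \<in> V \<and> adjacent (\<sigma> s) (\<sigma> s') \<and> P t s'} \<le> m * (c * 2)" .
qed

lemma finite_switches: "finite V \<Longrightarrow> finite (switches V \<sigma>)"
  by (rule finite_subset[of _ "V \<times> V \<times> V"]) (auto simp: switches_def)

text \<open>A bad switch violates a hypothesis of \<open>good_switchI\<close>. Old bonds at
  \<open>t\<close> or \<open>Suc t\<close> account for 4k * 2M triples, and at \<open>s\<close> or
  \<open>s'\<close> for 4kM each. Condition \<open>2\<close> excludes 5 * 5 positions
  \<open>s\<close> per \<open>t\<close>, hence 50M triples; condition \<open>3\<close> excludes 2 *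
  3 * 3 positions per \<open>t\<close>, hence 36M triples for each of \<open>s\<close> and
  \<open>s'\<close>.\<close>

lemma card_bad_switches:
  assumes V: "finite V" "card V = M" and bij: "bij_betw \<sigma> V W" and k: "card (bonds V \<sigma>) = k"
  shows "card (switches V \<sigma> - good_switches V \<sigma>) \<le> (16 * k + 122) * M"
proof -
  define Z where "Z = bonds V \<sigma> \<union> Suc ` bonds V \<sigma>"
  have inj: "inj_on \<sigma> V" using bij by (simp add: bij_betw_def)
  have finb: "finite (bonds V \<sigma>)" using V by (auto simp: bonds_def)
  have finZ: "finite Z" using finb by (simp add: Z_def)
  have ZV: "Z \<subseteq> V" by (auto simp: Z_def bonds_def)
  have cZ: "card Z \<le> 2 * k"
    unfolding Z_def using card_Un_le[of "bonds V \<sigma>" "Suc ` bonds V \<sigma>"] k card_image_le[OF finb, of Suc] by simp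
  define A where "A T P = {(t, s, s'). t \<in> T \<and> s \<in> V \<and> s' \<in> V \<and> adjacent (\<sigma> s) (\<sigma> s') \<and> P t s}"
    for T :: "nat set" and P :: "nat \<Rightarrow> nat \<Rightarrow> bool"
  define B where "B T P = {(t, s, s'). t \<in> T \<and> s \<in> V \<and> s' \<in> V \<and> adjacent (\<sigma> s) (\<sigma> s') \<and> P t s'}"
    for T :: "nat set" and P :: "nat \<Rightarrow> nat \<Rightarrow> bool"
  have fA: "finite (A T P)" and fB: "finite (B T P)" if "finite T" for T P
    unfolding A_def B_def using V that by (auto intro: rev_finite_subset[of "T \<times> V \<times> V"])
  define T1 where "T1 = {t \<in> V. t \<in> Z \<or> Suc t \<in> Z}"
  have "T1 \<subseteq> Z \<union> (\<lambda>z. z - 1) ` Z" by (force simp: T1_def)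
  then have "card T1 \<le> card (Z \<union> (\<lambda>z. z - 1) ` Z)" using finZ by (intro card_mono) auto
  then have cT1: "card T1 \<le> 4 * k"
    using cZ card_Un_le[of Z "(\<lambda>z. z - 1) ` Z"] card_image_le[OF finZ, of "\<lambda>z. z - 1"] by simp
  define P2 where "P2 t s \<longleftrightarrow> (\<exists>a\<in>{a \<in> V. near 2 a t}. near 2 (\<sigma> a) (\<sigma> s))" for t s
  define P3 where "P3 t y \<longleftrightarrow> (\<exists>x\<in>{t, Suc t}. \<exists>b\<in>{b \<in> V. near 1 (\<sigma> b) (\<sigma> x)}. near 1 b y)" for t y
  have sub: "switches V \<sigma> - good_switches V \<sigma> \<subseteq>
    A T1 (\<lambda>_ _. True) \<union> (A V (\<lambda>_ s. s \<in> Z) \<union> (B V (\<lambda>_ s. s \<in> Z) \<union> (A V P2 \<union> (A V P3 \<union> B V P3))))"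
  proof (rule subsetI, rule ccontr)
    fix x assume x: "x \<in> switches V \<sigma> - good_switches V \<sigma>"
      and n: "x \<notin> A T1 (\<lambda>_ _. True) \<union> (A V (\<lambda>_ s. s \<in> Z) \<union> (B V (\<lambda>_ s. s \<in> Z) \<union> (A V P2 \<union> (A V P3 \<union> B V P3))))"
    obtain t s s' where xx: "x = (t, s, s')" by (cases x)
    have sw: "(t, s, s') \<in> switches V \<sigma>" using x xx by simp
    have "(t, s, s') \<in> good_switches V \<sigma>"
      using n sw unfolding xx
      by (intro good_switchI[OF bij sw Z_def])
        (auto simp: A_def B_def T1_def P2_def P3_def switches_def)
    with x xx show False by simp
  qed
  have c1: "card (A T1 (\<lambda>_ _. True)) \<le> (4 * k) * (M * 2)"
    unfolding A_def using V finZ cT1 by (intro card_switches_restricted(1) inj) (auto simp: T1_def)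
  have zz: "card {y \<in> V. y \<in> Z} \<le> 2 * k" using cZ ZV by (auto simp: subset_iff intro: order.trans[OF card_mono[OF finZ]])
  have c2: "card (A V (\<lambda>_ s. s \<in> Z)) \<le> M * ((2 * k) * 2)"
    unfolding A_def using V zz by (intro card_switches_restricted(1) inj) auto
  have c3: "card (B V (\<lambda>_ s. s \<in> Z)) \<le> M * ((2 * k) * 2)"
    unfolding B_def using V zz by (intro card_switches_restricted(2) inj) auto
  have p2: "card {y \<in> V. P2 t y} \<le> 25" for t
  proof -
    have "{y \<in> V. P2 t y} = (\<Union>a\<in>{a \<in> V. near 2 a t}. {y \<in> V. near 2 (\<sigma> y) (\<sigma> a)})"
      by (auto simp: P2_def near_def)
    also have "card \<dots> \<le> 5 * 5"
      using V card_near[of V 2 t] card_near_image[OF inj, of 2] by (intro card_UN_le_mult) auto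
    finally show ?thesis by simp
  qed
  have p3: "card {y \<in> V. P3 t y} \<le> 18" for t
  proof -
    have "{y \<in> V. P3 t y} =
      (\<Union>x\<in>{t, Suc t}. \<Union>b\<in>{b \<in> V. near 1 (\<sigma> b) (\<sigma> x)}. {y \<in> V. near 1 y b})"
      by (auto simp: P3_def near_def)
    also have "card \<dots> \<le> 2 * (3 * 3)"
      using V card_near[of V 1] card_near_image[OF inj, of 1] by (intro card_UN_le_mult) auto
    finally show ?thesis by simp
  qed
  have c4: "card (A V P2) \<le> M * (25 * 2)"
    unfolding A_def using V p2 by (intro card_switches_restricted(1) inj) auto
  have c5: "card (A V P3) \<le> M * (18 * 2)"
    unfolding A_def using V p3 by (intro card_switches_restricted(1) inj) auto
  have c6: "card (B V P3) \<le> M * (18 * 2)"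
    unfolding B_def using V p3 by (intro card_switches_restricted(2) inj) auto
  have "card (switches V \<sigma> - good_switches V \<sigma>) \<le>
    card (A T1 (\<lambda>_ _. True) \<union> (A V (\<lambda>_ s. s \<in> Z) \<union> (B V (\<lambda>_ s. s \<in> Z) \<union> (A V P2 \<union> (A V P3 \<union> B V P3)))))"
    using V by (intro card_mono[OF _ sub] finite_UnI fA fB) (auto simp: T1_def)
  also have "\<dots> \<le> (4 * k) * (M * 2) + (M * ((2 * k) * 2) + (M * ((2 * k) * 2) + (M * (25 * 2) + (M * (18 * 2) + M * (18 * 2)))))"
    by (intro order.trans[OF card_Un_le] add_mono c1 c2 c3 c4 c5 c6)
  also have "\<dots> = (16 * k + 122) * M" by (simp add: algebra_simps)
  finally show ?thesis .
qed

text \<open>Positions with adjacent values correspond to pairs \<open>w\<close>,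
  \<open>Suc w\<close> in \<open>W\<close>, taken in either order, and \<open>t\<close> is chosen
  independently of them.\<close>

lemma card_switches:
  assumes V: "finite V" and bij: "bij_betw \<sigma> V W"
  shows "card (switches V \<sigma>) = card {t \<in> V. Suc t \<in> V} * (2 * card {w \<in> W. Suc w \<in> W})"
proof -
  have inj: "inj_on \<sigma> V" and W: "W = \<sigma> ` V" using bij by (auto simp: bij_betw_def)
  define E where "E = {w \<in> W. Suc w \<in> W}"
  define S where "S = {(s, s'). s \<in> V \<and> s' \<in> V \<and> adjacent (\<sigma> s) (\<sigma> s')}"
  have finE: "finite E" using V by (auto simp: E_def W)
  have "(\<lambda>(s, s'). (\<sigma> s, \<sigma> s')) ` S = (\<lambda>w. (w, Suc w)) ` E \<union> (\<lambda>w. (Suc w, w)) ` E"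
    unfolding S_def E_def W by (force simp: adjacent_def image_iff)
  moreover have "inj_on (\<lambda>(s, s'). (\<sigma> s, \<sigma> s')) S"
    using inj by (auto simp: S_def inj_on_def)
  ultimately have "card S = card ((\<lambda>w. (w, Suc w)) ` E \<union> (\<lambda>w. (Suc w, w)) ` E)"
    using card_image[of "\<lambda>(s, s'). (\<sigma> s, \<sigma> s')" S] by simp
  also have "\<dots> = card ((\<lambda>w. (w, Suc w)) ` E) + card ((\<lambda>w. (Suc w, w)) ` E)"
    using finE by (intro card_Un_disjoint) auto
  also have "\<dots> = 2 * card E" by (simp add: card_image inj_on_def)
  finally have S: "card S = 2 * card E" .
  have "switches V \<sigma> = {t \<in> V. Suc t \<in> V} \<times> S"
    by (auto simp: switches_def S_def)
  then show ?thesis using S by (simp add: card_cartesian_product E_def)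
qed

section \<open>Ratios of bond counts and the fraction exp (- 2)\<close>

definition bond_count :: "nat set \<Rightarrow> nat set \<Rightarrow> nat \<Rightarrow> nat" where
  "bond_count V W k = card {\<sigma> \<in> bijections V W. card (bonds V \<sigma>) = k}"

text \<open>Keeping the triple next to the switched bijection makes the map injective, by
  \<open>inj_switch\<close>. In the error term, \<open>4 * C\<close> pays for the gaps of
  \<open>V\<close> and \<open>W\<close>, since 2 (M - C)^2 \<ge> 2 M^2 - 4 C M, and
  \<open>16 * k + 122\<close> for the bad switches.\<close>

lemma switching:
  assumes V: "finite V" "card V = M" and W: "finite W" "card W = M"
    and eV: "M \<le> card {t \<in> V. Suc t \<in> V} + C" and eW: "M \<le> card {t \<in> W. Suc t \<in> W} + C"
    and CM: "C \<le> M" and M: "M > 0"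
  shows "real (Suc k) * real (bond_count V W (Suc k))
    \<ge> (2 - (4 * C + 16 * k + 122) / M) * real (bond_count V W k)"
proof -
  define A where "A j = {\<sigma> \<in> bijections V W. card (bonds V \<sigma>) = j}" for j
  have finA: "finite (A j)" for j
    unfolding A_def using finite_bijections[OF V(1) W(1)] by simp
  have finb: "finite (bonds V \<sigma>)" for \<sigma> using V by (auto simp: bonds_def)
  have img: "(\<lambda>(\<sigma>, x). (switch x \<sigma>, x)) ` (SIGMA \<sigma>:A k. good_switches V \<sigma>)
      \<subseteq> (SIGMA \<rho>:A (Suc k). bonds V \<rho> \<times> V \<times> V)"
  proof (clarsimp)
    fix \<sigma> t s s' assume a: "\<sigma> \<in> A k" "(t, s, s') \<in> good_switches V \<sigma>"
    then have sw: "t \<in> V" "Suc t \<in> V" "s \<in> V" "s' \<in> V" "t \<notin> bonds V \<sigma>"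
        "bonds V (switch (t, s, s') \<sigma>) = insert t (bonds V \<sigma>)"
      by (auto simp: good_switches_def switches_def)
    have "switch (t, s, s') \<sigma> \<in> bijections V W"
      using a sw by (intro switch_bijections) (auto simp: A_def)
    then show "switch (t, s, s') \<sigma> \<in> A (Suc k) \<and> t \<in> bonds V (switch (t, s, s') \<sigma>) \<and> s \<in> V \<and> s' \<in> V"
      using a sw finb by (simp add: A_def)
  qed
  have inj: "inj_on (\<lambda>(\<sigma>, x). (switch x \<sigma>, x)) X" for X
    using inj_switch by (auto simp: inj_on_def inj_def)
  have "(\<Sum>\<sigma>\<in>A k. card (good_switches V \<sigma>)) = card (SIGMA \<sigma>:A k. good_switches V \<sigma>)"
    using finA finite_switches[OF V(1)] by (simp add: good_switches_def)
  also have "\<dots> \<le> card (SIGMA \<rho>:A (Suc k). bonds V \<rho> \<times> V \<times> V)"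
    using finA finb V by (intro card_inj_on_le[OF inj img]) auto
  also have "\<dots> = (\<Sum>\<rho>\<in>A (Suc k). card (bonds V \<rho>) * (M * M))"
    using finA finb V by (simp add: card_cartesian_product)
  also have "\<dots> = card (A (Suc k)) * (Suc k * (M * M))"
    by (simp add: A_def)
  finally have up: "(\<Sum>\<sigma>\<in>A k. card (good_switches V \<sigma>)) \<le> card (A (Suc k)) * (Suc k * (M * M))" .
  have low: "2 * (real M - real C)\<^sup>2 - (16 * k + 122) * M \<le> real (card (good_switches V \<sigma>))"
    if "\<sigma> \<in> A k" for \<sigma>
  proof -
    have bij: "bij_betw \<sigma> V W" and k: "card (bonds V \<sigma>) = k"
      using that by (auto simp: A_def bijections_def)
    have "card (switches V \<sigma>) \<le> card (good_switches V \<sigma>) + card (switches V \<sigma> - good_switches V \<sigma>)"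
      using finite_switches[OF V(1)]
      by (subst card_Diff_subset) (auto simp: good_switches_def)
    then have "real (card (switches V \<sigma>)) \<le> card (good_switches V \<sigma>) + (16 * k + 122) * M"
      using card_bad_switches[OF V bij k] by linarith
    moreover have "(real M - real C) * (2 * (real M - real C)) \<le> real (card (switches V \<sigma>))"
      unfolding card_switches[OF V(1) bij] of_nat_mult using eV eW CM
      by (intro mult_mono) auto
    ultimately show ?thesis by (simp add: power2_eq_square algebra_simps)
  qed
  have "(2 - (4 * C + 16 * k + 122) / M) * M\<^sup>2 \<le> 2 * (real M - real C)\<^sup>2 - (16 * k + 122) * M"
    using M by (simp add: power2_eq_square field_simps)
  then have "card (A k) * ((2 - (4 * C + 16 * k + 122) / M) * M\<^sup>2)
    \<le> card (A k) * (2 * (real M - real C)\<^sup>2 - (16 * k + 122) * M)"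
    by (intro mult_left_mono) auto
  also have "\<dots> \<le> (\<Sum>\<sigma>\<in>A k. real (card (good_switches V \<sigma>)))"
    using sum_bounded_below[of "A k", OF low] by simp
  also have "\<dots> \<le> card (A (Suc k)) * (Suc k * (M * M))"
    using up by (metis of_nat_mono of_nat_sum)
  finally have "(card (A k) * (2 - (4 * C + 16 * k + 122) / M)) * M\<^sup>2 \<le> (Suc k * card (A (Suc k))) * M\<^sup>2"
    by (simp add: power2_eq_square algebra_simps)
  then have "card (A k) * (2 - (4 * C + 16 * k + 122) / M) \<le> Suc k * card (A (Suc k))"
    using M by (rule_tac mult_right_le_imp_le[where c = "real (M\<^sup>2)"]) auto
  then show ?thesis by (simp add: bond_count_def A_def algebra_simps)
qed

lemma card_bijections_le:
  assumes "finite V" "finite W" "card V = card W"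
  shows "card (bijections V W) \<le> fact (card V)"
proof -
  have "card (bijections V W) \<le> card {f \<in> V \<rightarrow>\<^sub>E W. inj_on f V}"
    using assms by (intro card_mono finite_subset[OF _ finite_PiE[of V "\<lambda>_. W"]])
      (auto simp: bijections_def PiE_def bij_betw_def)
  also have "\<dots> = fact (card V)"
    using assms card_inj_on_subset_funcset[of V W V]
    by (simp add: fact_prod_rev)
  finally show ?thesis .
qed

text \<open>The number of \<open>t\<close> with \<open>t\<close> and \<open>Suc t\<close> in
  \<open>V\<close> is M minus the number of maximal intervals of \<open>V\<close>. So the condition
  says that \<open>V\<close> and \<open>W\<close> each consist of at most \<open>C\<close>
  intervals.\<close>

definition almost_paths :: "nat \<Rightarrow> nat \<Rightarrow> nat set \<Rightarrow> nat set \<Rightarrow> bool" where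
  "almost_paths C M V W \<longleftrightarrow> finite V \<and> finite W \<and> card V = M \<and> card W = M \<and>
    M \<le> card {t \<in> V. Suc t \<in> V} + C \<and> M \<le> card {t \<in> W. Suc t \<in> W} + C"

text \<open>The ratios 2 / (j + 1) from \<open>switching\<close> multiply to 2^k / k!. The threshold
  \<open>M0\<close> depends on \<open>k\<close>, because the error in \<open>switching\<close> grows
  with \<open>k\<close>, but it is uniform in \<open>V\<close> and \<open>W\<close>.\<close>

lemma bond_count_ge:
  "\<exists>M0. \<forall>M\<ge>M0. \<forall>V W. almost_paths C M V W \<longrightarrow>
     (2 ^ k / fact k - \<delta>) * real (bond_count V W 0) \<le> real (bond_count V W k)"
  if "\<delta> > 0" for \<delta> :: real
  using that
proof (induction k arbitrary: \<delta>)
  case 0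
  then show ?case by (auto simp: algebra_simps)
next
  case (Suc k)
  define x :: real where "x = 2 ^ k / fact k"
  define c :: real where "c = 4 * C + 16 * k + 122"
  \<comment> \<open>The 2 keeps the factor \<open>2 - c / M\<close> nonnegative. The other entry
    limits \<open>c / M * x\<close> to half of \<delta>; the remaining half is twice the \<delta> /
    4 of the induction hypothesis.\<close>
  define \<eta> where "\<eta> = min 2 (\<delta> / (2 * x))"
  have pos: "x > 0" "c > 0" "\<eta> > 0" "\<delta> / 4 > 0"
    using Suc.prems by (auto simp: x_def c_def \<eta>_def)
  obtain M1 where M1: "\<And>M V W. M \<ge> M1 \<Longrightarrow> almost_paths C M V W \<Longrightarrow>
     (x - \<delta> / 4) * real (bond_count V W 0) \<le> real (bond_count V W k)"
    using Suc.IH[OF pos(4)] unfolding x_def by metis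
  define M0 where "M0 = Max {M1, C, 1, nat \<lceil>c / \<eta>\<rceil>}"
  show ?case
  proof (intro exI[of _ M0] allI impI)
    fix M V W
    assume M: "M0 \<le> M" and VW: "almost_paths C M V W"
    then have V: "finite V" and W: "finite W" and cV: "card V = M" and cW: "card W = M"
      and eV: "M \<le> card {t \<in> V. Suc t \<in> V} + C" and eW: "M \<le> card {t \<in> W. Suc t \<in> W} + C"
      by (auto simp: almost_paths_def)
    have "M1 \<le> M" "C \<le> M" "M > 0" "nat \<lceil>c / \<eta>\<rceil> \<le> M" using M by (auto simp: M0_def)
    then have "c / \<eta> \<le> M" by linarith
    then have \<eta>: "c / M \<le> \<eta>" using pos \<open>M > 0\<close> by (simp add: field_simps)
    have "2 * x - \<delta> \<le> (2 - c / M) * (x - \<delta> / 4)"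
    proof -
      have "c / M * x \<le> \<delta> / (2 * x) * x" using \<eta> pos by (intro mult_right_mono) (auto simp: \<eta>_def)
      then have "c / M * x \<le> \<delta> / 2" using pos by simp
      moreover have "0 \<le> c / M * (\<delta> / 4)" using pos by simp
      ultimately show ?thesis by (simp add: algebra_simps)
    qed
    then have "(2 * x - \<delta>) * bond_count V W 0 \<le> (2 - c / M) * ((x - \<delta> / 4) * bond_count V W 0)"
      by (simp add: mult.assoc[symmetric] mult_right_mono)
    also have "\<dots> \<le> (2 - c / M) * bond_count V W k"
      using \<eta> by (intro mult_left_mono M1[OF \<open>M1 \<le> M\<close> VW]) (auto simp: \<eta>_def)
    also have "\<dots> \<le> real (Suc k) * bond_count V W (Suc k)"
      using switching[OF V cV W cW eV eW \<open>C \<le> M\<close> \<open>M > 0\<close>, of k] by (simp add: c_def)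
    finally have 1: "(2 * x - \<delta>) * bond_count V W 0 / Suc k \<le> bond_count V W (Suc k)"
      by (simp add: field_simps)
    have "2 ^ Suc k / fact (Suc k) - \<delta> \<le> (2 * x - \<delta>) / Suc k"
    proof -
      have "\<delta> / Suc k \<le> \<delta> / 1" using Suc.prems by (intro divide_left_mono) auto
      then show ?thesis by (simp add: x_def diff_divide_distrib mult.commute)
    qed
    then have "(2 ^ Suc k / fact (Suc k) - \<delta>) * bond_count V W 0 \<le> (2 * x - \<delta>) / Suc k * bond_count V W 0"
      by (intro mult_right_mono) auto
    with 1 show "(2 ^ Suc k / fact (Suc k) - \<delta>) * bond_count V W 0 \<le> bond_count V W (Suc k)"
      by simp
  qed
qed

text \<open>Summing \<open>bond_count_ge\<close> over k < K bounds a 0 times a partial sum of the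
  series of exp 2 by the number of all bijections, hence by M!.\<close>

lemma bondless_le:
  assumes "\<epsilon> > (0 :: real)"
  shows "\<exists>M0. \<forall>M\<ge>M0. \<forall>V W. almost_paths C M V W \<longrightarrow>
     real (card {\<sigma> \<in> bijections V W. bonds V \<sigma> = {}}) \<le> (exp (- 2) + \<epsilon>) * fact M"
proof -
  define s where "s = 1 / (exp (- 2) + \<epsilon>)"
  have pos: "exp (- 2) + \<epsilon> > 0" using assms by (intro add_pos_pos) auto
  have "1 / (exp (- 2) + \<epsilon>) < 1 / exp (- 2)"
    using assms pos by (intro divide_strict_left_mono) auto
  also have "1 / exp (- 2) = exp (2 :: real)" by (simp add: exp_minus divide_inverse)
  finally have s: "s > 0" "s < exp 2"
    using pos by (simp_all add: s_def)
  \<comment> \<open>Half of the slack \<open>exp 2 - s\<close> pays for truncating the series at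
    \<open>K\<close>, the other half for the \<open>K\<close> errors \<delta>.\<close>
  define \<eta> where "\<eta> = (exp 2 - s) / 2"
  have \<eta>: "\<eta> > 0" using s by (simp add: \<eta>_def)
  have "(\<lambda>k. 2 ^ k / fact k) sums (exp 2 :: real)"
    using exp_converges[of "2 :: real"] by (simp add: scaleR_conv_of_real divide_inverse mult.commute)
  then have "(\<lambda>K. \<Sum>k<K. 2 ^ k / fact k) \<longlonglongrightarrow> (exp 2 :: real)" by (simp add: sums_def)
  then have "\<forall>\<^sub>F K in sequentially. (\<Sum>k<K. 2 ^ k / fact k :: real) > exp 2 - \<eta>"
    using \<eta> by (intro order_tendstoD(1)) auto
  then obtain K where K: "(\<Sum>k<K. 2 ^ k / fact k :: real) > exp 2 - \<eta>"
    by (auto simp: eventually_sequentially)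
  define \<delta> where "\<delta> = \<eta> / Suc K"
  have \<delta>: "\<delta> > 0" using \<eta> by (simp add: \<delta>_def)
  have "\<exists>g. \<forall>k. \<forall>M\<ge>g k. \<forall>V W. almost_paths C M V W \<longrightarrow>
     (2 ^ k / fact k - \<delta>) * real (bond_count V W 0) \<le> real (bond_count V W k)"
    by (intro choice allI bond_count_ge \<delta>)
  then obtain g where g: "\<And>k M V W. M \<ge> g k \<Longrightarrow> almost_paths C M V W \<Longrightarrow>
     (2 ^ k / fact k - \<delta>) * real (bond_count V W 0) \<le> real (bond_count V W k)"
    by blast
  show ?thesis
  proof (intro exI[of _ "\<Sum>k<K. g k"] allI impI)
    fix M V W
    assume M: "(\<Sum>k<K. g k) \<le> M" and VW: "almost_paths C M V W"
    then have V: "finite V" and W: "finite W" and cV: "card V = M" and cW: "card W = M"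
      and eV: "M \<le> card {t \<in> V. Suc t \<in> V} + C" and eW: "M \<le> card {t \<in> W. Suc t \<in> W} + C"
      by (auto simp: almost_paths_def)
    have finb: "finite (bonds V \<sigma>)" for \<sigma> using V by (auto simp: bonds_def)
    have gM: "g k \<le> M" if "k < K" for k
      using M member_le_sum[of k "{..<K}" g] that by simp
    have "s * bond_count V W 0 \<le> ((\<Sum>k<K. 2 ^ k / fact k) - K * \<delta>) * bond_count V W 0"
    proof (intro mult_right_mono)
      have "K * \<delta> \<le> \<eta>" using \<eta> by (simp add: \<delta>_def field_simps)
      then show "s \<le> (\<Sum>k<K. 2 ^ k / fact k) - K * \<delta>" using K by (simp add: \<eta>_def field_simps)
    qed simp
    also have "\<dots> = (\<Sum>k<K. (2 ^ k / fact k - \<delta>) * bond_count V W 0)"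
      by (simp add: left_diff_distrib sum_subtractf sum_distrib_right)
    also have "\<dots> \<le> (\<Sum>k<K. real (bond_count V W k))"
      using gM by (intro sum_mono g[OF _ VW]) auto
    also have "\<dots> = real (card (\<Union>k<K. {\<sigma> \<in> bijections V W. card (bonds V \<sigma>) = k}))"
      unfolding bond_count_def using finite_bijections[OF V W]
      by (subst card_UN_disjoint) auto
    also have "\<dots> \<le> real (card (bijections V W))"
      using finite_bijections[OF V W] by (intro of_nat_mono card_mono) auto
    also have "\<dots> \<le> fact M"
      using card_bijections_le[OF V W] cV cW by (metis of_nat_fact of_nat_mono)
    finally have "bond_count V W 0 \<le> fact M / s" using s by (simp add: field_simps)
    moreover have "bond_count V W 0 = card {\<sigma> \<in> bijections V W. bonds V \<sigma> = {}}"
      using finb by (simp add: bond_count_def)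
    ultimately show "real (card {\<sigma> \<in> bijections V W. bonds V \<sigma> = {}}) \<le> (exp (- 2) + \<epsilon>) * fact M"
      by (simp add: s_def mult.commute)
  qed
qed

section \<open>Words describing merged pairs of paths\<close>

text \<open>The vertices of the path \<open>Q\<close> are given as \<open>q ! j = p ! \<tau> j\<close>, so that the edge \<open>{i, Suc i}\<close> of
  indices stands for the \<open>i\<close>-th edge of \<open>P\<close> and \<open>{\<tau> j, \<tau> (Suc j)}\<close> for the \<open>j\<close>-th edge of \<open>Q\<close>. In
  the recursions along a word, \<open>i\<close> and \<open>j\<close> are the numbers of edges of \<open>P\<close> and \<open>Q\<close> used so far;
  \<open>agreement\<close> collects the pairs \<open>(a, b)\<close> for which the shared letters force \<open>\<tau> a = b\<close>.\<close>

datatype step = OnlyP | OnlyQ | Fwd | Rev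

definition shared :: "step \<Rightarrow> bool" where
  "shared x \<longleftrightarrow> x = Fwd \<or> x = Rev"

lemma shared_simps [simp]: "\<not> shared OnlyP" "\<not> shared OnlyQ" "shared Fwd" "shared Rev"
  by (auto simp: shared_def)

fun agreement :: "nat \<Rightarrow> nat \<Rightarrow> step list \<Rightarrow> (nat \<times> nat) set" where
  "agreement i j [] = {}"
| "agreement i j (OnlyP # u) = agreement (Suc i) j u"
| "agreement i j (OnlyQ # u) = agreement i (Suc j) u"
| "agreement i j (Fwd # u) = {(j, i), (Suc j, Suc i)} \<union> agreement (Suc i) (Suc j) u"
| "agreement i j (Rev # u) = {(j, Suc i), (Suc j, i)} \<union> agreement (Suc i) (Suc j) u"

fun merged :: "(nat \<Rightarrow> nat) \<Rightarrow> nat \<Rightarrow> nat \<Rightarrow> step list \<Rightarrow> nat set list" where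
  "merged \<tau> i j [] = []"
| "merged \<tau> i j (OnlyP # u) = {i, Suc i} # merged \<tau> (Suc i) j u"
| "merged \<tau> i j (OnlyQ # u) = {\<tau> j, \<tau> (Suc j)} # merged \<tau> i (Suc j) u"
| "merged \<tau> i j (Fwd # u) = {i, Suc i} # merged \<tau> (Suc i) (Suc j) u"
| "merged \<tau> i j (Rev # u) = {i, Suc i} # merged \<tau> (Suc i) (Suc j) u"

fun q_only :: "nat \<Rightarrow> step list \<Rightarrow> nat set" where
  "q_only j [] = {}"
| "q_only j (OnlyP # u) = q_only j u"
| "q_only j (OnlyQ # u) = insert j (q_only (Suc j) u)"
| "q_only j (Fwd # u) = q_only (Suc j) u"
| "q_only j (Rev # u) = q_only (Suc j) u"

definition p_steps :: "step list \<Rightarrow> nat" where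
  "p_steps u = length (filter (\<lambda>x. x \<noteq> OnlyQ) u)"

definition q_steps :: "step list \<Rightarrow> nat" where
  "q_steps u = length (filter (\<lambda>x. x \<noteq> OnlyP) u)"

definition shared_steps :: "step list \<Rightarrow> nat" where
  "shared_steps u = length (filter shared u)"

text \<open>A run is counted at its last letter, so that one letter of lookahead suffices.\<close>

fun runs :: "step list \<Rightarrow> nat" where
  "runs [] = 0"
| "runs (x # u) = (if shared x \<and> (u = [] \<or> \<not> shared (hd u)) then 1 else 0) + runs u"

fun isolated :: "step list \<Rightarrow> bool" where
  "isolated [] \<longleftrightarrow> True"
| "isolated (x # u) \<longleftrightarrow> isolated u \<and> (u \<noteq> [] \<and> shared x \<and> shared (hd u) \<longrightarrow> x = Fwd \<and> hd u = Fwd)"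

text \<open>This is the part of a merge that does not involve labels. Distinctness makes every
  common edge of the two paths appear as a shared letter.\<close>

definition describes :: "nat \<Rightarrow> (nat \<Rightarrow> nat) \<Rightarrow> step list \<Rightarrow> bool" where
  "describes n \<tau> u \<longleftrightarrow> p_steps u = n - 1 \<and> q_steps u = n - 1 \<and>
    (\<forall>(a, b) \<in> agreement 0 0 u. \<tau> a = b) \<and> distinct (merged \<tau> 0 0 u)"

lemma length_merged: "length (merged \<tau> i j u) = length u"
  by (induction \<tau> i j u rule: merged.induct) auto

lemma length_word: "length u + shared_steps u = p_steps u + q_steps u"
proof (induction u)
  case (Cons x u)
  then show ?case by (cases x) (auto simp: p_steps_def q_steps_def shared_steps_def)
qed (simp add: p_steps_def q_steps_def shared_steps_def)

lemma shared_steps_le: "shared_steps u \<le> p_steps u"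
  unfolding shared_steps_def p_steps_def
  by (induction u) (auto simp: shared_def)

lemma runs_le: "runs u \<le> shared_steps u"
  by (induction u) (auto simp: shared_steps_def)

lemma agreement_bounds:
  "agreement i j u \<subseteq> {j..j + q_steps u} \<times> {i..i + p_steps u}"
  by (induction i j u rule: agreement.induct) (force simp: q_steps_def p_steps_def)+

lemma finite_agreement: "finite (agreement i j u)"
  by (rule finite_subset[OF agreement_bounds]) simp

text \<open>This separates consecutive runs: after \<open>OnlyQ\<close> all later positions exceed
  \<open>j\<close>, and after \<open>OnlyP\<close> all later values exceed \<open>i\<close>. So the
  next run cannot reuse the vertex where a forward run ended.\<close>

lemma agreement_next:
  assumes "(j, b) \<in> agreement i j u" "u = [] \<or> \<not> shared (hd u)"
  shows "i < b"
proof (cases u)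
  case (Cons x v)
  then consider "x = OnlyP" | "x = OnlyQ" using assms by (cases x) auto
  then show ?thesis
    using assms Cons agreement_bounds[of "Suc i" j v] agreement_bounds[of i "Suc j" v]
    by cases auto
qed (use assms in auto)

text \<open>Two neighbouring shared letters both prescribe \<open>\<tau> (Suc j)\<close>, and the
  prescriptions agree only for \<open>Fwd\<close> after \<open>Fwd\<close>; that gives
  \<open>isolated\<close>. Within a run neighbouring letters have one position in common, while
  different runs have none, so a run of l letters fixes l + 1 positions.\<close>

lemma card_agreement:
  assumes "\<forall>(a, b) \<in> agreement i j u. \<tau> a = b"
  shows "card (fst ` agreement i j u) = shared_steps u + runs u" "isolated u"
proof -
  have "card (fst ` agreement i j u) = shared_steps u + runs u \<and> isolated u"
    using assms
  proof (induction i j u rule: agreement.induct)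
    case (4 i j u)
    let ?A = "agreement (Suc i) (Suc j) u"
    have IH: "card (fst ` ?A) = shared_steps u + runs u" "isolated u" and ag: "\<forall>(a, b) \<in> ?A. \<tau> a = b"
      and \<tau>: "\<tau> (Suc j) = Suc i" using 4 by auto
    have b: "fst ` ?A \<subseteq> {Suc j..}" using agreement_bounds[of "Suc i" "Suc j" u] by force
    show ?case
    proof (cases "u = [] \<or> \<not> shared (hd u)")
      case True
      have "Suc j \<notin> fst ` ?A"
      proof
        assume "Suc j \<in> fst ` ?A"
        then obtain b where "(Suc j, b) \<in> ?A" by force
        then show False using agreement_next[OF _ True] ag \<tau> by fastforce
      qed
      moreover have "j \<notin> fst ` ?A" using b by force
      ultimately show ?thesis using True IH finite_agreement
        by (auto simp: shared_steps_def card_insert_if)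
    next
      case False
      then obtain x v where u: "u = x # v" "shared x" by (cases u) auto
      have x: "x = Fwd" using u ag \<tau> by (cases x) auto
      then have "Suc j \<in> fst ` ?A" using u by simp
      then have "fst ` agreement i j (Fwd # u) = insert j (fst ` ?A)" by (auto simp: image_Un)
      moreover have "j \<notin> fst ` ?A" using b by force
      moreover have "isolated (Fwd # u)" "runs (Fwd # u) = runs u" using u x IH by auto
      ultimately show ?thesis using IH finite_agreement
        by (simp add: shared_steps_def)
    qed
  next
    case (5 i j u)
    let ?A = "agreement (Suc i) (Suc j) u"
    have IH: "card (fst ` ?A) = shared_steps u + runs u" "isolated u" and ag: "\<forall>(a, b) \<in> ?A. \<tau> a = b"
      and \<tau>: "\<tau> (Suc j) = i" using 5 by auto
    have b: "fst ` ?A \<subseteq> {Suc j..}" "snd ` ?A \<subseteq> {Suc i..}"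
      using agreement_bounds[of "Suc i" "Suc j" u] by force+
    have nj: "Suc j \<notin> fst ` ?A"
    proof
      assume "Suc j \<in> fst ` ?A"
      then obtain c where "(Suc j, c) \<in> ?A" by force
      then show False using b ag \<tau> by force
    qed
    have "u = [] \<or> \<not> shared (hd u)"
    proof (rule ccontr)
      assume "\<not> ?thesis"
      then obtain x v where "u = x # v" "shared x" by (cases u) auto
      then show False using nj by (cases x) auto
    qed
    moreover have "j \<notin> fst ` ?A" using b by force
    ultimately show ?case using IH finite_agreement nj
      by (auto simp: shared_steps_def card_insert_if)
  qed (auto simp: shared_steps_def)
  then show "card (fst ` agreement i j u) = shared_steps u + runs u" "isolated u" by auto
qed

text \<open>A shared letter at \<open>j\<close> puts \<open>j\<close> into the domain of
  \<open>agreement\<close>. Hence at a free position the next edge of Q is used by Q only.\<close>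

lemma q_only_cover: "{j..<j + q_steps u} \<subseteq> q_only j u \<union> fst ` agreement i j u"
proof (induction i j u rule: agreement.induct)
  case (3 i j u)
  then show ?case by (auto simp: q_steps_def subset_iff Suc_le_eq) (metis le_neq_implies_less)
next
  case (4 i j u)
  then show ?case by (auto simp: q_steps_def subset_iff Suc_le_eq) (metis le_neq_implies_less)
next
  case (5 i j u)
  then show ?case by (auto simp: q_steps_def subset_iff Suc_le_eq) (metis le_neq_implies_less)
qed (auto simp: q_steps_def)

lemma set_merged_q: "(\<lambda>j. {\<tau> j, \<tau> (Suc j)}) ` q_only j u \<subseteq> set (merged \<tau> i j u)"
  by (induction \<tau> i j u rule: merged.induct) auto

lemma set_merged_p: "(\<lambda>i. {i, Suc i}) ` {i..<i + p_steps u} \<subseteq> set (merged \<tau> i j u)"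
proof (induction \<tau> i j u rule: merged.induct)
  case (2 \<tau> i j u)
  have "{i..<i + p_steps (OnlyP # u)} = insert i {Suc i..<Suc i + p_steps u}"
    by (auto simp: p_steps_def)
  then show ?case using 2 by auto
next
  case (4 \<tau> i j u)
  have "{i..<i + p_steps (Fwd # u)} = insert i {Suc i..<Suc i + p_steps u}"
    by (auto simp: p_steps_def)
  then show ?case using 4 by auto
next
  case (5 \<tau> i j u)
  have "{i..<i + p_steps (Rev # u)} = insert i {Suc i..<Suc i + p_steps u}"
    by (auto simp: p_steps_def)
  then show ?case using 5 by auto
qed (auto simp: p_steps_def)

text \<open>Every edge of P and every Q-only edge has its own entry in \<open>merged\<close>, so
  distinctness keeps them apart.\<close>

lemma merged_disjoint:
  assumes "distinct (merged \<tau> i j u)" "i' \<in> {i..<i + p_steps u}" "j' \<in> q_only j u"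
  shows "{i', Suc i'} \<noteq> {\<tau> j', \<tau> (Suc j')}"
  using assms
proof (induction \<tau> i j u rule: merged.induct)
  case (2 \<tau> i j u)
  show ?case
  proof (cases "i' = i")
    case True
    then show ?thesis using 2 set_merged_q[of \<tau> j u "Suc i"] by auto
  next
    case False
    then show ?thesis using 2 by (auto simp: p_steps_def)
  qed
next
  case (3 \<tau> i j u)
  show ?case
  proof (cases "j' = j")
    case True
    then have "{i', Suc i'} \<in> set (merged \<tau> i (Suc j) u)"
      using 3 set_merged_p[of i u \<tau> "Suc j"] by (auto simp: p_steps_def)
    then show ?thesis using 3 True by auto
  next
    case False
    then show ?thesis using 3 by (auto simp: p_steps_def)
  qed
next
  case (4 \<tau> i j u)
  show ?case
  proof (cases "i' = i")
    case True
    then show ?thesis using 4 set_merged_q[of \<tau> "Suc j" u "Suc i"] by auto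
  next
    case False
    then show ?thesis using 4 by (auto simp: p_steps_def)
  qed
next
  case (5 \<tau> i j u)
  show ?case
  proof (cases "i' = i")
    case True
    then show ?thesis using 5 set_merged_q[of \<tau> "Suc j" u "Suc i"] by auto
  next
    case False
    then show ?thesis using 5 by (auto simp: p_steps_def)
  qed
qed auto

text \<open>Each maximal interval of the complement ends just before \<open>n\<close> or before an
  element of \<open>J\<close>, so there are at most \<open>card J + 1\<close> of them.\<close>

lemma card_successive_complement:
  assumes "finite J"
  shows "card ({..<n} - J) \<le> card {t \<in> {..<n} - J. Suc t \<in> {..<n} - J} + (card J + 1)"
proof -
  let ?V = "{..<n} - J"
  have "?V \<subseteq> {t \<in> ?V. Suc t \<in> ?V} \<union> (\<lambda>t. t - 1) ` insert n J"
  proof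
    fix t assume t: "t \<in> ?V"
    have "t = Suc t - 1" by simp
    with t show "t \<in> {t \<in> ?V. Suc t \<in> ?V} \<union> (\<lambda>t. t - 1) ` insert n J"
      by (cases "Suc t \<in> insert n J") (blast, auto)
  qed
  then have "card ?V \<le> card ({t \<in> ?V. Suc t \<in> ?V} \<union> (\<lambda>t. t - 1) ` insert n J)"
    using assms by (intro card_mono) auto
  also have "\<dots> \<le> card {t \<in> ?V. Suc t \<in> ?V} + card ((\<lambda>t. t - 1) ` insert n J)"
    by (rule card_Un_le)
  also have "card ((\<lambda>t. t - 1) ` insert n J) \<le> card (insert n J)"
    using assms by (intro card_image_le) auto
  also have "\<dots> \<le> card J + 1" using assms by (simp add: card_insert_if)
  finally show ?thesis by simp
qed

text \<open>Restriction to the free positions loses nothing, because \<open>agreement\<close> fixes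
  \<tau> on \<open>J\<close>. It leaves no bond, because a bond would be an edge of P that is also
  Q-only. The gap bound \<open>2 * k + 1\<close> is card J + 1 with card J = k + r and r \<le>
  k.\<close>

lemma card_described_le:
  fixes u :: "step list"
  defines "k \<equiv> shared_steps u" and "r \<equiv> runs u"
  assumes ex: "\<tau>0 \<in> bijections {..<n} {..<n}" "describes n \<tau>0 u" and n: "n > 0"
  shows "k + r \<le> n" "isolated u"
    "\<exists>V W. almost_paths (2 * k + 1) (n - k - r) V W \<and>
       card {\<tau> \<in> bijections {..<n} {..<n}. describes n \<tau> u} \<le> card {\<sigma> \<in> bijections V W. bonds V \<sigma> = {}}"
proof -
  define J where "J = fst ` agreement 0 0 u"
  define I where "I = snd ` agreement 0 0 u"
  define V where "V = {..<n} - J"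
  define W where "W = {..<n} - I"
  have J: "finite J" "finite I" using finite_agreement by (auto simp: J_def I_def)
  have steps: "p_steps u = n - 1" "q_steps u = n - 1" using ex by (auto simp: describes_def)
  have Jn: "J \<subseteq> {..<n}" "I \<subseteq> {..<n}"
    using agreement_bounds[of 0 0 u] n unfolding steps J_def I_def by force+
  have ag0: "\<forall>(a, b) \<in> agreement 0 0 u. \<tau>0 a = b" using ex by (simp add: describes_def)
  show "isolated u" using card_agreement(2)[OF ag0] .
  have cJ: "card J = k + r" using card_agreement(1)[OF ag0] by (simp add: J_def k_def r_def)
  then show "k + r \<le> n" using card_mono[OF _ Jn(1)] by simp
  have rk: "r \<le> k" using runs_le by (simp add: r_def k_def)
  have img: "\<tau> ` J = I" if "describes n \<tau> u" for \<tau>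
    using that unfolding describes_def J_def I_def by force
  have bijV: "bij_betw \<tau> V W" if "\<tau> \<in> bijections {..<n} {..<n}" "describes n \<tau> u" for \<tau>
  proof -
    have "bij_betw \<tau> {..<n} {..<n}" using that by (simp add: bijections_def)
    then show ?thesis unfolding V_def W_def using img[OF that(2)] Jn
      by (metis bij_betw_subset bij_betw_DiffI bij_betw_def inj_on_subset)
  qed
  have cI: "card I = k + r"
  proof -
    have "inj_on \<tau>0 J" using ex Jn by (auto simp: bijections_def bij_betw_def intro: inj_on_subset)
    then show ?thesis using img[OF ex(2)] cJ card_image by metis
  qed
  have "almost_paths (2 * k + 1) (n - k - r) V W"
    using card_successive_complement[OF J(1), of n] card_successive_complement[OF J(2), of n]
      cJ cI J Jn rk
    by (auto simp: almost_paths_def V_def W_def card_Diff_subset)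
  moreover have "card {\<tau> \<in> bijections {..<n} {..<n}. describes n \<tau> u} \<le> card {\<sigma> \<in> bijections V W. bonds V \<sigma> = {}}"
  proof (rule card_inj_on_le[where f = "\<lambda>\<tau>. restrict \<tau> V"])
    show "inj_on (\<lambda>\<tau>. restrict \<tau> V) {\<tau> \<in> bijections {..<n} {..<n}. describes n \<tau> u}"
    proof (intro inj_onI, clarify, rule ext)
      fix \<tau> \<rho> x
      assume a: "\<tau> \<in> bijections {..<n} {..<n}" "describes n \<tau> u" "\<rho> \<in> bijections {..<n} {..<n}" "describes n \<rho> u"
        and eq: "restrict \<tau> V = restrict \<rho> V"
      consider "x \<in> V" | "x \<in> J" | "x \<notin> {..<n}" by (auto simp: V_def)
      then show "\<tau> x = \<rho> x"
      proof cases
        case 1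
        then show ?thesis using fun_cong[OF eq, of x] by simp
      next
        case 2
        then obtain b where "(x, b) \<in> agreement 0 0 u" by (auto simp: J_def)
        then show ?thesis using a by (auto simp: describes_def)
      next
        case 3
        then show ?thesis using a by (auto simp: bijections_def extensional_def)
      qed
    qed
    show "(\<lambda>\<tau>. restrict \<tau> V) ` {\<tau> \<in> bijections {..<n} {..<n}. describes n \<tau> u} \<subseteq> {\<sigma> \<in> bijections V W. bonds V \<sigma> = {}}"
    proof clarify
      fix \<tau> assume a: "\<tau> \<in> bijections {..<n} {..<n}" "describes n \<tau> u"
      have "restrict \<tau> V \<in> bijections V W" using bijV[OF a] by (simp add: bijections_def bij_betw_restrict_eq)
      moreover have "bonds V (restrict \<tau> V) = {}"
      proof (rule ccontr)
        assume "bonds V (restrict \<tau> V) \<noteq> {}"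
        then obtain t where t: "t \<in> V" "Suc t \<in> V" "adjacent (\<tau> t) (\<tau> (Suc t))" by (auto simp: bonds_def)
        define i where "i = min (\<tau> t) (\<tau> (Suc t))"
        have i: "{i, Suc i} = {\<tau> t, \<tau> (Suc t)}" using t by (auto simp: i_def adjacent_def)
        have "\<tau> t < n" "\<tau> (Suc t) < n" using t a by (auto simp: bijections_def bij_betw_def V_def)
        then have "i \<in> {0..<0 + p_steps u}" using t unfolding steps i_def by (auto simp: adjacent_def)
        moreover have "t \<in> q_only 0 u"
        proof -
          have "t \<in> {0..<0 + q_steps u}" using t unfolding steps by (auto simp: V_def)
          then show ?thesis using q_only_cover[of 0 u 0] t(1) by (auto simp: V_def J_def)
        qed
        ultimately show False
          using merged_disjoint[of \<tau> 0 0 u i t] a i by (auto simp: describes_def)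
      qed
      ultimately show "restrict \<tau> V \<in> bijections V W \<and> bonds V (restrict \<tau> V) = {}" by simp
    qed
    show "finite {\<sigma> \<in> bijections V W. bonds V \<sigma> = {}}"
      using finite_bijections[of V W] by (simp add: V_def W_def)
  qed
  ultimately show "\<exists>V W. almost_paths (2 * k + 1) (n - k - r) V W \<and>
       card {\<tau> \<in> bijections {..<n} {..<n}. describes n \<tau> u} \<le> card {\<sigma> \<in> bijections V W. bonds V \<sigma> = {}}"
    by blast
qed

section \<open>Asymptotics of the weights\<close>

text \<open>The number of sequences of \<open>r\<close> nonempty runs of total length \<open>k\<close>, where a run of length \<open>1\<close>
  comes in two directions.\<close>

fun run_comps :: "nat \<Rightarrow> nat \<Rightarrow> nat" where
  "run_comps 0 k = (if k = 0 then 1 else 0)"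
| "run_comps (Suc r) k = (if k = 0 then 0 else run_comps r (k - 1)) + (\<Sum>l=1..k. run_comps r (k - l))"

text \<open>The convolution form, in which \<open>convolution_le\<close> applies: a single letter
  has weight 2, a longer run weight 1.\<close>

lemma run_comps_Suc:
  "real (run_comps (Suc r) k) =
    (\<Sum>l\<le>k. (if l = 0 then 0 else if l = 1 then 2 else 1) * real (run_comps r (k - l)))"
proof (cases k)
  case (Suc k')
  let ?g = "\<lambda>l. real (run_comps r (k - l))"
  have "(\<Sum>l\<le>k. (if l = 0 then 0 else if l = 1 then 2 else 1) * ?g l)
      = (\<Sum>i\<le>k'. (if i = 0 then ?g 1 else 0) + ?g (Suc i))"
    unfolding Suc by (subst sum.atMost_Suc_shift) (auto intro!: sum.cong)
  also have "\<dots> = ?g 1 + (\<Sum>i\<le>k'. ?g (Suc i))"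
    by (simp add: sum.distrib)
  also have "(\<Sum>i\<le>k'. ?g (Suc i)) = (\<Sum>l=1..k. ?g l)"
    unfolding Suc One_nat_def sum.shift_bounds_cl_Suc_ivl by (simp add: atMost_atLeast0)
  finally show ?thesis using Suc by simp
qed simp

lemma convolution_le:
  fixes a b :: "nat \<Rightarrow> real"
  assumes "\<And>i. a i \<ge> 0" "\<And>i. b i \<ge> 0"
  shows "(\<Sum>k\<le>n. \<Sum>i\<le>k. a i * b (k - i)) \<le> (\<Sum>i\<le>n. a i) * (\<Sum>j\<le>n. b j)"
proof -
  have "(\<Sum>k\<le>n. \<Sum>i\<le>k. a i * b (k - i)) = (\<Sum>(i, j)\<in>{(i, j). i + j \<le> n}. a i * b j)"
    by (rule sum.triangle_reindex_eq[symmetric])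
  also have "\<dots> \<le> (\<Sum>(i, j)\<in>{..n} \<times> {..n}. a i * b j)"
    using assms by (intro sum_mono2) auto
  also have "\<dots> = (\<Sum>i\<le>n. a i) * (\<Sum>j\<le>n. b j)"
    by (simp add: sum_product sum.cartesian_product)
  finally show ?thesis .
qed

text \<open>One run has generating function 2x + x^2 + x^3 + ... = x + x / (1 - x), and
  \<open>r\<close> runs have its \<open>r\<close>-th power. Nonnegativity allows truncated series to
  be multiplied.\<close>

lemma run_comps_gf:
  assumes x: "0 \<le> x" "x < (1 :: real)"
  shows "(\<Sum>k\<le>n. real (run_comps r k) * x ^ k) \<le> (x + x / (1 - x)) ^ r"
proof (induction r)
  case 0
  show ?case by (simp add: if_distrib[of real] if_distrib[of "\<lambda>t. t * _"] sum.delta cong: if_cong)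
next
  case (Suc r)
  define w :: "nat \<Rightarrow> real" where "w l = (if l = 0 then 0 else if l = 1 then 2 else 1)" for l
  have w: "(\<Sum>l\<le>n. w l * x ^ l) \<le> x + x / (1 - x)"
  proof (cases n)
    case 0
    then show ?thesis using x by (simp add: w_def)
  next
    case (Suc n')
    have "(\<Sum>l\<le>n. w l * x ^ l) = (\<Sum>i\<le>n'. (if i = 0 then x else 0) + x * x ^ i)"
      unfolding Suc by (subst sum.atMost_Suc_shift) (auto intro!: sum.cong simp: w_def)
    also have "\<dots> = x + x * (\<Sum>i<Suc n'. x ^ i)"
      by (simp add: sum.distrib sum_distrib_left lessThan_Suc_atMost)
    also have "(\<Sum>i<Suc n'. x ^ i) \<le> 1 / (1 - x)"
      using x by (subst sum_gp_strict) (auto intro!: divide_right_mono)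
    finally show ?thesis using x by (simp add: mult_left_mono)
  qed
  have "(\<Sum>k\<le>n. real (run_comps (Suc r) k) * x ^ k) =
      (\<Sum>k\<le>n. \<Sum>l\<le>k. (w l * x ^ l) * (real (run_comps r (k - l)) * x ^ (k - l)))"
    unfolding run_comps_Suc w_def[symmetric] sum_distrib_right
    by (intro sum.cong refl) (simp add: power_add[symmetric] mult_ac)
  also have "\<dots> \<le> (\<Sum>l\<le>n. w l * x ^ l) * (\<Sum>k\<le>n. real (run_comps r k) * x ^ k)"
    using x by (intro convolution_le) (auto simp: w_def)
  also have "\<dots> \<le> (x + x / (1 - x)) * (x + x / (1 - x)) ^ r"
    using x by (intro mult_mono w Suc sum_nonneg) auto
  finally show ?case by simp
qed

text \<open>With a = 2 and x = 1/2 this is the main term exp 3; with a = 4 and x = 17/18 it is the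
  majorant of the tail.\<close>

lemma run_comps_sum_le:
  assumes x: "0 \<le> x" "x < (1 :: real)" and a: "a \<ge> 0"
  shows "(\<Sum>k\<le>n. \<Sum>r\<le>k. real (run_comps r k) * a ^ r / fact r * x ^ k) \<le> exp (a * (x + x / (1 - x)))"
proof -
  let ?y = "x + x / (1 - x)"
  have y: "?y \<ge> 0" using x by simp
  have "(\<Sum>k\<le>n. \<Sum>r\<le>k. real (run_comps r k) * a ^ r / fact r * x ^ k) \<le>
    (\<Sum>k\<le>n. \<Sum>r\<le>n. real (run_comps r k) * a ^ r / fact r * x ^ k)"
    using x a by (intro sum_mono sum_mono2) auto
  also have "\<dots> = (\<Sum>r\<le>n. a ^ r / fact r * (\<Sum>k\<le>n. real (run_comps r k) * x ^ k))"
    by (subst sum.swap) (simp add: sum_distrib_left mult_ac)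
  also have "\<dots> \<le> (\<Sum>r\<le>n. a ^ r / fact r * ?y ^ r)"
    using x a by (intro sum_mono mult_left_mono run_comps_gf) auto
  also have "\<dots> = (\<Sum>r\<in>{..n}. (a * ?y) ^ r /\<^sub>R fact r)"
    by (simp add: power_mult_distrib divide_inverse mult_ac)
  also have "\<dots> \<le> exp (a * ?y)"
    unfolding exp_def using a y by (intro sum_le_suminf summable_exp_generic) auto
  finally show ?thesis .
qed

lemma fact_rising: "fact (N + k) = (fact N * (\<Prod>i=1..k. real N + real i))"
  by (induction k) (simp_all add: mult_ac)

lemma fact_falling: "r \<le> N \<Longrightarrow> fact N = (fact (N - r) * (\<Prod>i<r. real N - real i))"
proof (induction r)
  case (Suc r)
  then have "fact (N - r) = (real N - real r) * fact (N - Suc r)"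
    by (subst fact_reduce) (auto simp: of_nat_diff)
  then show ?case using Suc by simp
qed simp

text \<open>\<open>term_bound n k r\<close> bounds the contribution of the words with \<open>k\<close> shared letters in \<open>r\<close> runs to
  \<open>E X\<^sup>2 / n\<^sup>2\<close> if the condition that no further edges are shared is dropped.\<close>

definition overlap :: "nat \<Rightarrow> nat \<Rightarrow> real" where
  "overlap n k = fact n * real ((2 * (n - 1 - k)) choose (n - 1 - k)) * fact (n - k) / fact (2 * (n - 1) - k) / (real n)\<^sup>2"

definition term_bound :: "nat \<Rightarrow> nat \<Rightarrow> nat \<Rightarrow> real" where
  "term_bound n k r = fact n * (real ((2 * (n - 1 - k)) choose (n - 1 - k)) *
    (real ((2 * (n - 1 - k) + 1) choose r) * real (run_comps r k))) * fact (n - k - r) / fact (2 * (n - 1) - k) / (real n)\<^sup>2"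

lemma term_bound_nonneg: "term_bound n k r \<ge> 0"
  by (simp add: term_bound_def)

text \<open>After cancelling the central binomial, each shared edge leaves one factor, which is near
  1/2 while \<open>k\<close> is small compared with \<open>n\<close>.\<close>

lemma overlap_eq:
  assumes k: "k < n"
  defines "x \<equiv> real n - real k"
  shows "overlap n k = (x / n)\<^sup>2 * (\<Prod>i=1..k. (x + real i) / (2 * x - 2 + real i))"
proof -
  define N where "N = n - k"
  have N: "N > 0" "n = N + k" "real N = x" using k by (auto simp: N_def x_def)
  let ?A = "\<Prod>i=1..k. x + real i" and ?D = "\<Prod>i=1..k. 2 * x - 2 + real i"
  have m: "n - 1 - k = N - 1" "n - k = N" "2 * (n - 1) - k = 2 * (N - 1) + k" using N by auto
  have x1: "real (2 * (N - 1)) = 2 * x - 2" using N by (auto simp: of_nat_diff)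
  have 1: "fact n = fact N * ?A" unfolding N(2) by (simp add: fact_rising N(3))
  have 2: "fact (2 * (N - 1) + k) = fact (2 * (N - 1)) * ?D"
    unfolding fact_rising x1 by simp
  have 5: "real ((2 * (N - 1)) choose (N - 1)) = fact (2 * (N - 1)) / (fact (N - 1))\<^sup>2"
    by (subst binomial_fact) (auto simp: power2_eq_square mult_2)
  have 6: "fact N = x * fact (N - 1)" using N by (subst fact_reduce) auto
  have D: "?D \<noteq> 0" using 2 by (metis fact_nonzero mult_zero_right)
  have x: "x > 0" using N by simp
  have "overlap n k = (fact N * ?A) * (fact (2 * (N - 1)) / (fact (N - 1))\<^sup>2) * fact N
      / (fact (2 * (N - 1)) * ?D) / (real n)\<^sup>2"
    unfolding overlap_def m 1 2 5 by simp
  also have "fact (N - 1) = fact N / x" using 6 x by simp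
  also have "(fact N * ?A) * (fact (2 * (N - 1)) / (fact N / x)\<^sup>2) * fact N
      / (fact (2 * (N - 1)) * ?D) / (real n)\<^sup>2 = (x / n)\<^sup>2 * (?A / ?D)"
    by (simp add: power2_eq_square power_divide mult_ac)
  also have "?A / ?D = (\<Prod>i=1..k. (x + real i) / (2 * x - 2 + real i))"
    by (simp add: prod_dividef)
  finally show ?thesis .
qed

text \<open>\<open>overlap\<close> collects what does not depend on \<open>r\<close>. The quotient
  in the middle weighs the places for \<open>r\<close> runs against the \<open>r\<close> additional
  fixed vertices; for fixed \<open>k\<close> and \<open>r\<close> it tends to 2^r / r!.\<close>

lemma term_bound_eq_overlap:
  assumes k: "k < n" and r: "k + r \<le> n"
  shows "term_bound n k r = real (run_comps r k) * (real ((2 * (n - k) - 1) choose r) * fact (n - k - r) / fact (n - k)) * overlap n k"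
proof -
  have "2 * (n - 1 - k) + 1 = 2 * (n - k) - 1" using k by simp
  then show ?thesis unfolding term_bound_def overlap_def by simp
qed

lemma term_bound_eq:
  assumes k: "k < n" and r: "k + r \<le> n"
  defines "x \<equiv> real n - real k"
  shows "term_bound n k r = real (run_comps r k) / fact r * ((x / n)\<^sup>2 *
    (\<Prod>i=1..k. (x + real i) / (2 * x - 2 + real i))) * (\<Prod>i<r. (2 * x - 1 - real i) / (x - real i))"
proof -
  define N where "N = n - k"
  have N: "N > 0" "real N = x" "r \<le> N" "r \<le> 2 * N - 1" using k r by (auto simp: N_def x_def)
  let ?B = "\<Prod>i<r. x - real i" and ?C = "\<Prod>i<r. 2 * x - 1 - real i"
  have x1: "real (2 * N - 1) = 2 * x - 1" using N by (auto simp: of_nat_diff)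
  have 3: "fact N = fact (N - r) * ?B" using fact_falling[OF N(3)] N(2) by simp
  have "real ((2 * N - 1) choose r) = fact (2 * N - 1) / (fact r * fact (2 * N - 1 - r))"
    using N(4) by (rule binomial_fact)
  also have "fact (2 * N - 1) = fact (2 * N - 1 - r) * ?C"
    using fact_falling[OF N(4)] unfolding x1 .
  finally have 4: "real ((2 * N - 1) choose r) = ?C / fact r" by simp
  have "real ((2 * N - 1) choose r) * fact (N - r) / fact N = ?C / ?B / fact r"
    unfolding 4 3 by simp
  also have "?C / ?B = (\<Prod>i<r. (2 * x - 1 - real i) / (x - real i))"
    by (simp add: prod_dividef)
  finally show ?thesis
    unfolding term_bound_eq_overlap[OF k r] overlap_eq[OF k] N_def[symmetric] x_def by simp
qed

lemma term_bound_tendsto: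
  "(\<lambda>n. term_bound n k r) \<longlonglongrightarrow> real (run_comps r k) * 2 ^ r / fact r * (1 / 2) ^ k"
proof -
  let ?f = "\<lambda>n. real (run_comps r k) / fact r * (((real n - real k) / n)\<^sup>2 *
    (\<Prod>i=1..k. ((real n - real k) + real i) / (2 * (real n - real k) - 2 + real i))) *
    (\<Prod>i<r. (2 * (real n - real k) - 1 - real i) / ((real n - real k) - real i))"
  have 1: "(\<lambda>n. (real n - real k) / n) \<longlonglongrightarrow> 1" by real_asymp
  have 2: "(\<lambda>n. ((real n - real k) + real i) / (2 * (real n - real k) - 2 + real i)) \<longlonglongrightarrow> 1 / 2" for i
    by real_asymp
  have 3: "(\<lambda>n. (2 * (real n - real k) - 1 - real i) / ((real n - real k) - real i)) \<longlonglongrightarrow> 2" for i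
    by real_asymp
  have "?f \<longlonglongrightarrow> real (run_comps r k) / fact r * (1\<^sup>2 * (\<Prod>i=1..k. 1 / 2)) * (\<Prod>i<r. 2)"
    by (intro tendsto_intros 1 2 3)
  also have "real (run_comps r k) / fact r * (1\<^sup>2 * (\<Prod>i=1..k. 1 / 2)) * (\<Prod>i<r. 2) =
    real (run_comps r k) * 2 ^ r / fact r * (1 / 2) ^ k" by simp
  finally have lim: "?f \<longlonglongrightarrow> real (run_comps r k) * 2 ^ r / fact r * (1 / 2) ^ k" .
  have "\<forall>\<^sub>F n in sequentially. ?f n = term_bound n k r"
    using eventually_gt_at_top[of "k + r"]
    by eventually_elim (subst term_bound_eq, auto)
  then show ?thesis by (rule Lim_transform_eventually[OF lim])
qed

section \<open>Bounds uniform in k and r\<close>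

lemma double_binomial_le: "r \<le> N \<Longrightarrow> (2 * N) choose r \<le> 4 ^ r * (N choose r)"
proof (induction r arbitrary: N)
  case (Suc r)
  then obtain M where N: "N = Suc M" "r \<le> M" by (cases N) auto
  have "(2 * M + 1 - r) * ((2 * M + 1) choose r) = (2 * M + 1) * ((2 * M) choose r)"
    using binomial_absorb_comp[of "2 * M + 1" r] by simp
  \<comment> \<open>From \<open>r \<le> M\<close>. This 2 and the 2 of \<open>2 * Suc M\<close> in
    the absorption identity below make up the factor 4 per step.\<close>
  also have "\<dots> \<le> (2 * M + 1 - r) * (2 * ((2 * M) choose r))"
  proof -
    have "2 * M + 1 \<le> (2 * M + 1 - r) * 2" using N by simp
    then show ?thesis by (metis mult.assoc mult_le_mono1)
  qed
  finally have "(2 * M + 1) choose r \<le> 2 * ((2 * M) choose r)" using N by simp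
  also have "\<dots> \<le> 2 * (4 ^ r * (M choose r))" using Suc.IH[OF N(2)] by simp
  finally have le: "(2 * M + 1) choose r \<le> 2 * (4 ^ r * (M choose r))" .
  have "Suc r * ((2 * Suc M) choose Suc r) = 2 * Suc M * ((2 * M + 1) choose r)"
    using binomial_absorption[of r "2 * Suc M"] by simp
  also have "\<dots> \<le> 2 * Suc M * (2 * (4 ^ r * (M choose r)))"
    by (rule mult_le_mono2[OF le])
  also have "\<dots> = 4 ^ Suc r * (Suc M * (M choose r))" by (simp add: algebra_simps)
  also have "Suc M * (M choose r) = Suc r * (Suc M choose Suc r)"
    using binomial_absorption[of r "Suc M"] by simp
  finally have "Suc r * ((2 * Suc M) choose Suc r) \<le> Suc r * (4 ^ Suc r * (Suc M choose Suc r))"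
    by (simp only: mult_ac)
  then show ?case unfolding N by (simp only: mult_le_cancel1)
qed simp

text \<open>The limiting factor 2 per run is exceeded when \<open>r\<close> is comparable with n -
  k, whereas 4 holds throughout by \<open>double_binomial_le\<close>.\<close>

lemma term_bound_le:
  assumes k: "k < n" and r: "k + r \<le> n"
  shows "term_bound n k r \<le> real (run_comps r k) * 4 ^ r / fact r * overlap n k"
proof -
  define N where "N = n - k"
  have N: "r \<le> N" "N > 0" using k r by (auto simp: N_def)
  have "(2 * N - 1) choose r \<le> (2 * N) choose r" by (rule binomial_right_mono) simp
  also have "\<dots> \<le> 4 ^ r * (N choose r)" by (rule double_binomial_le[OF N(1)])
  finally have "real ((2 * N - 1) choose r) \<le> 4 ^ r * real (N choose r)"
    by (metis of_nat_le_iff of_nat_mult of_nat_numeral of_nat_power)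
  also have "\<dots> = 4 ^ r * (fact N / (fact r * fact (N - r)))" using N by (simp add: binomial_fact)
  finally have "real ((2 * N - 1) choose r) * (fact (N - r) / fact N) \<le>
      4 ^ r * (fact N / (fact r * fact (N - r))) * (fact (N - r) / fact N)"
    by (rule mult_right_mono) simp
  then have "real ((2 * N - 1) choose r) * fact (N - r) / fact N \<le> 4 ^ r / fact r" by simp
  then have "real (run_comps r k) * (real ((2 * N - 1) choose r) * fact (N - r) / fact N) * overlap n k
      \<le> real (run_comps r k) * (4 ^ r / fact r) * overlap n k"
    by (intro mult_right_mono mult_left_mono) (auto simp: overlap_def)
  then show ?thesis unfolding term_bound_eq_overlap[OF k r] N_def by simp
qed

text \<open>A factor (x + i) / (2x - 2 + i) is at most 16/17 if and only if i \<le> 15x - 32. The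
  cut at n / 8 gives i \<le> k < 7x, and n \<ge> 32 then gives x \<ge> 4, which makes 7x \<le> 15x -
  32.\<close>

lemma term_bound_le_geometric:
  assumes k: "k < n" and r: "k + r \<le> n" and big: "n < 8 * (n - k)" "n \<ge> 32"
  shows "term_bound n k r \<le> real (run_comps r k) * 4 ^ r / fact r * (16 / 17) ^ k"
proof -
  define x where "x = real n - real k"
  have x: "x \<ge> 4" "real k < 7 * x" "x \<le> n" using big k by (auto simp: x_def)
  have "overlap n k = (x / n)\<^sup>2 * (\<Prod>i=1..k. (x + real i) / (2 * x - 2 + real i))"
    unfolding x_def by (rule overlap_eq[OF k])
  also have "\<dots> \<le> 1 * (\<Prod>i=1..k. 16 / 17)"
  proof (intro mult_mono prod_mono conjI prod_nonneg)
    show "(x / n)\<^sup>2 \<le> 1" using x by (intro power_le_one) auto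
    fix i assume i: "i \<in> {1..k}"
    then have "real i \<le> k" by simp
    then show "(x + real i) / (2 * x - 2 + real i) \<le> 16 / 17" using x by (simp add: field_simps)
    show "0 \<le> (x + real i) / (2 * x - 2 + real i)" using x by simp
  qed (use x in auto)
  finally have "overlap n k \<le> (16 / 17) ^ k" by simp
  then show ?thesis
    by (intro order.trans[OF term_bound_le[OF k r]] mult_left_mono) auto
qed

text \<open>Splitting \<open>k\<close> into \<open>Suc r\<close> parts leaves \<open>r\<close> free
  cut points, and each run has at most two forms. Having \<open>r\<close> rather than
  \<open>Suc r\<close> below in the binomial is the source of the factor 1 / n near the
  diagonal.\<close>

lemma run_comps_le: "run_comps (Suc r) k \<le> 2 ^ Suc r * (k choose r)"
proof (induction r arbitrary: k)
  case 0
  have "(\<Sum>l=1..k. run_comps 0 (k - l)) \<le> 1"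
  proof -
    have "(\<Sum>l=1..k. run_comps 0 (k - l)) = (\<Sum>l=1..k. if l = k then 1 else 0)"
      by (intro sum.cong) auto
    then show ?thesis by (simp add: sum.delta)
  qed
  then show ?case by simp
next
  case (Suc r)
  have "(\<Sum>l=1..k. run_comps (Suc r) (k - l)) \<le> (\<Sum>l=1..k. 2 ^ Suc r * ((k - l) choose r))"
    by (intro sum_mono Suc)
  also have "\<dots> = 2 ^ Suc r * (\<Sum>l=1..k. (k - l) choose r)"
    by (simp only: sum_distrib_left)
  also have "(\<Sum>l=1..k. (k - l) choose r) = (\<Sum>i<k. i choose r)"
    by (rule sum.reindex_bij_witness[of _ "\<lambda>i. k - i" "\<lambda>l. k - l"]) auto
  also have "\<dots> = k choose Suc r"
    using sum_choose_upper[of r "k - 1"] by (cases k) (auto simp: lessThan_Suc_atMost atMost_atLeast0)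
  finally have 1: "(\<Sum>l=1..k. run_comps (Suc r) (k - l)) \<le> 2 ^ Suc r * (k choose Suc r)" .
  have 2: "(if k = 0 then 0 else run_comps (Suc r) (k - 1)) \<le> 2 ^ Suc r * (k choose Suc r)"
  proof (cases k)
    case (Suc k')
    have "run_comps (Suc r) k' \<le> 2 ^ Suc r * (k' choose r)" by (rule Suc.IH)
    also have "\<dots> \<le> 2 ^ Suc r * (k choose Suc r)" using Suc by simp
    finally show ?thesis using Suc by simp
  qed simp
  have "run_comps (Suc (Suc r)) k \<le> 2 ^ Suc r * (k choose Suc r) + 2 ^ Suc r * (k choose Suc r)"
    unfolding run_comps.simps(2)[of "Suc r"] by (rule add_mono[OF 2 1])
  then show ?case by (simp del: run_comps.simps add: mult_ac)
qed

lemma binomial_fact_le_power: "(k choose r) * fact r \<le> k ^ r"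
  by (metis binomial_fact_pow mult.commute)

lemma fact_le_fact_mult_power: "fact (r + m) \<le> fact r * (r + m) ^ m"
proof (induction m)
  case (Suc m)
  have "fact (r + Suc m) = (r + Suc m) * fact (r + m)" by simp
  also have "\<dots> \<le> (r + Suc m) * (fact r * (r + m) ^ m)" by (intro mult_left_mono Suc) auto
  also have "\<dots> \<le> (r + Suc m) * (fact r * (r + Suc m) ^ m)"
    by (intro mult_left_mono power_mono) auto
  finally show ?case by (simp add: mult_ac)
qed simp

text \<open>For N \<ge> 1, the N - 1 factors that lead from n! to (n + N - 1)! are all at least
  \<open>n\<close>.\<close>

lemma fact_mult_power_le: "fact n * n ^ Suc N \<le> n\<^sup>2 * fact (n + N - 1)" if "n > 0"
proof (induction N)
  case 0
  then show ?case using that by (simp add: fact_reduce power2_eq_square)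
next
  case (Suc N)
  have "fact n * n ^ Suc (Suc N) = n * (fact n * n ^ Suc N)" by simp
  also have "\<dots> \<le> (n + N) * (n\<^sup>2 * fact (n + N - 1))" by (intro mult_mono Suc) auto
  also have "\<dots> = n\<^sup>2 * fact (n + Suc N - 1)"
    using that by (simp add: fact_reduce[of "n + N"])
  finally show ?case .
qed

text \<open>Put N = n - k and m = N - Suc r. The run lengths contribute n^r, the quotient of
  factorials n^(-N), and N! at most (Suc r)! N^m, which leaves (1 / n) (N / n)^m \<le> (1 / n)
  8^(-m). The cut at 1/8 beats the 4^N of the central binomial: 8^(r+1) 8^(-m) 4^N = 64^(r+1)
  2^(-N).\<close>

lemma term_bound_le_small:
  assumes k: "k < n" and r: "k + Suc r \<le> n" and small: "8 * (n - k) \<le> n"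
  shows "term_bound n k (Suc r) \<le> 1 / n * (64 * 64 ^ r / fact r * (1 / 2) ^ (n - k))"
proof -
  define N where "N = n - k"
  define m where "m = N - Suc r"
  have N: "N > 0" "N = Suc r + m" "8 * N \<le> n" "n = N + k" "n > 0" using k r small by (auto simp: N_def m_def)
  have c: "real (run_comps (Suc r) k) \<le> 2 ^ Suc r * (real n ^ r / fact r)"
  proof -
    have "real (run_comps (Suc r) k) \<le> 2 ^ Suc r * real (k choose r)"
      using run_comps_le[of r k] by (metis of_nat_le_iff of_nat_mult of_nat_numeral of_nat_power)
    also have "real (k choose r) \<le> real k ^ r / fact r"
      using binomial_fact_le_power[of k r]
      by (simp add: field_simps) (metis of_nat_fact of_nat_le_iff of_nat_mult of_nat_power mult.commute)
    also have "real k ^ r \<le> real n ^ r" using k by (intro power_mono) auto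
    finally show ?thesis by (simp add: divide_right_mono mult_left_mono)
  qed
  have f: "fact N \<le> fact (Suc r) * real N ^ m"
  proof -
    have "real (fact N) \<le> real (fact (Suc r) * N ^ m)"
      using fact_le_fact_mult_power[of "Suc r" m] unfolding N(2)[symmetric] by (rule of_nat_mono)
    then show ?thesis by (simp del: fact_Suc)
  qed
  have "fact n * real n ^ N \<le> (real n)\<^sup>2 * fact (2 * (n - 1) - k)"
  proof -
    have e: "2 * (n - 1) - k = n + (N - 1) - 1" using N by auto
    have "fact n * n ^ N \<le> n\<^sup>2 * fact (2 * (n - 1) - k)"
      using fact_mult_power_le[OF N(5), of "N - 1"] N(1) unfolding e by simp
    then have "real (fact n * n ^ N) \<le> real (n\<^sup>2 * fact (2 * (n - 1) - k))" by (rule of_nat_mono)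
    then show ?thesis by simp
  qed
  then have q: "fact n / (fact (2 * (n - 1) - k) * (real n)\<^sup>2) \<le> 1 / real n ^ N"
    using N(5) by (simp add: field_simps)
  have b: "real ((2 * (n - 1 - k)) choose (n - 1 - k)) \<le> 4 ^ N"
  proof -
    have "(2 * (n - 1 - k)) choose (n - 1 - k) \<le> 2 ^ (2 * (n - 1 - k))" by (rule binomial_le_pow2)
    also have "\<dots> \<le> 2 ^ (2 * N)" by (intro power_increasing) (auto simp: N_def)
    also have "\<dots> = 4 ^ N" by (simp add: power_mult)
    finally show ?thesis by (metis of_nat_le_iff of_nat_numeral of_nat_power)
  qed
  have "overlap n k = fact n / (fact (2 * (n - 1) - k) * (real n)\<^sup>2) * (real ((2 * (n - 1 - k)) choose (n - 1 - k)) * fact N)"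
    by (simp add: overlap_def N_def)
  also have "\<dots> \<le> 1 / real n ^ N * (4 ^ N * (fact (Suc r) * real N ^ m))"
    by (intro mult_mono q b f) auto
  finally have ov: "overlap n k \<le> 4 ^ N * fact (Suc r) * real N ^ m / real n ^ N" by simp
  have "term_bound n k (Suc r) \<le> real (run_comps (Suc r) k) * 4 ^ Suc r / fact (Suc r) * overlap n k"
    by (rule term_bound_le[OF k r])
  also have "\<dots> \<le> (2 ^ Suc r * (real n ^ r / fact r)) * 4 ^ Suc r / fact (Suc r) * (4 ^ N * fact (Suc r) * real N ^ m / real n ^ N)"
    by (intro mult_mono divide_right_mono c ov) (auto simp: overlap_def)
  also have "\<dots> = 2 ^ Suc r * 4 ^ Suc r / fact r * 4 ^ N * (real N ^ m * (real n ^ r / real n ^ N))"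
    by simp
  also have "real n ^ r / real n ^ N = 1 / (real n * real n ^ m)"
    using N by (simp add: power_add)
  also have "2 ^ Suc r * 4 ^ Suc r / fact r * 4 ^ N * (real N ^ m * (1 / (real n * real n ^ m)))
      = 8 ^ Suc r / fact r * 4 ^ N * (real N / n) ^ m / n"
    by (simp add: power_divide flip: power_mult_distrib)
  also have "\<dots> \<le> 8 ^ Suc r / fact r * 4 ^ N * (1 / 8) ^ m / n"
    using N by (intro divide_right_mono mult_left_mono power_mono) (auto simp: field_simps)
  also have "\<dots> = (8 ^ Suc r * (1 / 8) ^ m * 4 ^ N) / (fact r * n)"
    by (simp add: mult_ac)
  also have "(8::real) ^ Suc r * (1 / 8) ^ m * 4 ^ N = 64 ^ Suc r * (1 / 2) ^ N"
  proof -
    have "(8::real) ^ m = 4 ^ m * 2 ^ m" "(64::real) ^ r = 8 ^ r * (4 ^ r * 2 ^ r)"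
      by (simp_all flip: power_mult_distrib)
    then show ?thesis unfolding N(2) by (simp add: power_add power_divide)
  qed
  finally have "term_bound n k (Suc r) \<le> 64 ^ Suc r * (1 / 2) ^ N / (fact r * n)" .
  then show ?thesis unfolding N_def by (simp add: mult_ac)
qed

section \<open>Counting words\<close>

text \<open>Code \<open>0\<close> is the empty run, code \<open>1\<close> a reverse letter, and code \<open>l + 1\<close> a run of \<open>l\<close> forward
  letters.\<close>

fun run_word :: "nat \<Rightarrow> step list" where
  "run_word 0 = []"
| "run_word (Suc 0) = [Rev]"
| "run_word (Suc (Suc l)) = replicate (Suc l) Fwd"

fun weave :: "step list \<Rightarrow> nat list \<Rightarrow> step list" where
  "weave [] g = run_word (hd g)"
| "weave (x # v) g = run_word (hd g) @ x # weave v (tl g)"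

definition codes :: "nat \<Rightarrow> nat \<Rightarrow> nat \<Rightarrow> nat list set" where
  "codes l k r = {g. length g = l \<and> (\<Sum>c\<leftarrow>g. length (run_word c)) = k \<and> length (filter (\<lambda>c. c \<noteq> 0) g) = r}"

lemma hd_weave:
  assumes "u = weave (filter (\<lambda>x. \<not> shared x) u) (c # g)"
  shows "c = 0 \<longleftrightarrow> u = [] \<or> \<not> shared (hd u)" "c = Suc 0 \<Longrightarrow> hd u = Rev"
proof -
  define v where "v = filter (\<lambda>x. \<not> shared x) u"
  have v: "\<forall>x\<in>set v. \<not> shared x" by (simp add: v_def)
  have u: "u = weave v (c # g)" using assms by (simp add: v_def)
  show "c = 0 \<longleftrightarrow> u = [] \<or> \<not> shared (hd u)" "c = Suc 0 \<Longrightarrow> hd u = Rev"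
    using u v by (cases v; cases c rule: run_word.cases; auto)+
qed

lemma weave_Suc:
  "weave v (Suc (Suc (Suc l)) # g) = Fwd # weave v (Suc (Suc l) # g)"
  "weave v (Suc (Suc 0) # g) = Fwd # weave v (0 # g)"
  "weave v (Suc 0 # g) = Rev # weave v (0 # g)"
  by (cases v; simp)+

text \<open>For an upper bound the coding only has to be surjective. A shared letter put in front
  turns a first code 0 into 1 (\<open>Rev\<close>) or 2 (\<open>Fwd\<close>). If a run is already
  there, isolation forces \<open>Fwd\<close> on both sides and the code grows by one.\<close>

lemma isolated_weave:
  assumes "isolated u"
  shows "\<exists>g \<in> codes (Suc (length (filter (\<lambda>x. \<not> shared x) u))) (shared_steps u) (runs u).
    u = weave (filter (\<lambda>x. \<not> shared x) u) g"
  using assms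
proof (induction u)
  case Nil
  show ?case by (intro bexI[of _ "[0]"]) (auto simp: codes_def shared_steps_def)
next
  case (Cons x u)
  let ?v = "filter (\<lambda>x. \<not> shared x) u"
  obtain g0 where g0: "g0 \<in> codes (Suc (length ?v)) (shared_steps u) (runs u)" and u0: "u = weave ?v g0"
    using Cons by auto
  then obtain c g where g: "g0 = c # g" by (cases g0) (auto simp: codes_def)
  note u = u0[unfolded g] and code = g0[unfolded g]
  note hd = hd_weave[OF u]
  show ?case
  proof (cases "shared x")
    case False
    then have "x # u = weave (filter (\<lambda>x. \<not> shared x) (x # u)) (0 # c # g)"
      using u by simp
    moreover have "0 # c # g \<in> codes (Suc (length (filter (\<lambda>x. \<not> shared x) (x # u)))) (shared_steps (x # u)) (runs (x # u))"
      using False code by (simp add: codes_def shared_steps_def)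
    ultimately show ?thesis by blast
  next
    case True
    define c' where "c' = (if x = Rev then 1 else if c = 0 then 2 else Suc c)"
    have F: "c \<noteq> 0 \<Longrightarrow> x = Fwd \<and> c \<noteq> 1"
      using hd Cons.prems True by (cases u) auto
    have "x # u = weave ?v (c' # g)"
    proof (cases "c = 0")
      case True
      then show ?thesis
        using \<open>shared x\<close> u weave_Suc(2,3)[of ?v g] by (auto simp: c'_def shared_def numeral_2_eq_2)
    next
      case False
      then obtain l where "c = Suc (Suc l)" using F by (cases c rule: run_word.cases) auto
      then show ?thesis using u F[OF False] weave_Suc(1)[of ?v l g] by (simp add: c'_def)
    qed
    moreover have "c' # g \<in> codes (Suc (length ?v)) (shared_steps (x # u)) (runs (x # u))"
    proof (cases "c = 0")
      case 0: True
      then have "u = [] \<or> \<not> shared (hd u)" using hd by simp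
      then show ?thesis
        using True code 0 by (auto simp: codes_def c'_def shared_steps_def shared_def numeral_2_eq_2)
    next
      case False
      then obtain l where "c = Suc (Suc l)" using F by (cases c rule: run_word.cases) auto
      moreover have "\<not> (u = [] \<or> \<not> shared (hd u))" using hd False by simp
      ultimately show ?thesis
        using True code F[OF False] by (auto simp: codes_def c'_def shared_steps_def)
    qed
    moreover have "filter (\<lambda>x. \<not> shared x) (x # u) = ?v" using True by simp
    ultimately show ?thesis by metis
  qed
qed

text \<open>The first gap is empty (\<open>A\<close>), holds a reverse letter (\<open>B\<close>) or
  holds j forward letters (\<open>D\<close>). The last two cases reproduce the recursion of
  \<open>run_comps\<close>, and Pascal's rule joins the binomials.\<close>

lemma finite_codes: "finite (codes l k r)"
  and card_codes: "card (codes l k r) \<le> (l choose r) * run_comps r k"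
proof -
  have "finite (codes l k r) \<and> card (codes l k r) \<le> (l choose r) * run_comps r k"
  proof (induction l arbitrary: k r)
    case 0
    have "codes 0 k r = (if k = 0 \<and> r = 0 then {[]} else {})" by (auto simp: codes_def)
    then show ?case by (cases r) auto
  next
    case (Suc l)
    show ?case
    proof (cases r)
      case 0
      have "codes (Suc l) k 0 = (#) 0 ` codes l k 0"
        by (auto simp: codes_def length_Suc_conv image_iff split: if_splits)
      then show ?thesis using Suc[of k 0] by (auto intro: order.trans[OF card_image_le] simp: 0)
    next
      case (Suc r')
      define A where "A = (#) 0 ` codes l k r"
      define B where "B = (if k = 0 then {} else (#) 1 ` codes l (k - 1) r')"
      define D where "D = (\<Union>j\<in>{1..k}. (#) (Suc j) ` codes l (k - j) r')"
      have len: "length (run_word (Suc j)) = j" if "j \<ge> 1" "Suc j \<noteq> 1" for j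
        using that by (cases j) auto
      have sub: "codes (Suc l) k r \<subseteq> A \<union> (B \<union> D)"
      proof
        fix g' assume g': "g' \<in> codes (Suc l) k r"
        then obtain c g where g: "g' = c # g" by (cases g') (auto simp: codes_def)
        consider "c = 0" | "c = 1" | j where "c = Suc (Suc j)" by (cases c rule: run_word.cases) auto
        then show "g' \<in> A \<union> (B \<union> D)"
        proof cases
          case 1
          then show ?thesis using g g' by (auto simp: A_def codes_def)
        next
          case 2
          then show ?thesis using g g' Suc by (auto simp: B_def codes_def)
        next
          case (3 j)
          then have "Suc j \<in> {1..k}" "g \<in> codes l (k - Suc j) r'" using g g' Suc by (auto simp: codes_def)
          then show ?thesis using g 3 unfolding D_def by blast
        qed
      qed
      have fin: "finite A" "finite B" "finite D"
        using Suc.IH by (auto simp: A_def B_def D_def)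
      have cA: "card A \<le> (l choose r) * run_comps r k"
        using Suc.IH[of k r] by (auto simp: A_def card_image)
      have cB: "card B \<le> (l choose r') * (if k = 0 then 0 else run_comps r' (k - 1))"
        using Suc.IH[of "k - 1" r'] by (auto simp: B_def card_image)
      have "card D \<le> (\<Sum>j=1..k. card ((#) (Suc j) ` codes l (k - j) r'))"
        unfolding D_def by (intro card_UN_le) auto
      also have "\<dots> \<le> (\<Sum>j=1..k. (l choose r') * run_comps r' (k - j))"
        using Suc.IH by (intro sum_mono) (auto simp: card_image)
      finally have cD: "card D \<le> (l choose r') * (\<Sum>j=1..k. run_comps r' (k - j))"
        by (simp add: sum_distrib_left)
      have "card (codes (Suc l) k r) \<le> card (A \<union> (B \<union> D))"
        using fin sub by (intro card_mono) auto
      also have "\<dots> \<le> card A + (card B + card D)"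
        by (intro order.trans[OF card_Un_le] add_left_mono card_Un_le)
      also have "\<dots> \<le> (l choose r) * run_comps r k + ((l choose r') * (if k = 0 then 0 else run_comps r' (k - 1))
          + (l choose r') * (\<Sum>j=1..k. run_comps r' (k - j)))"
        by (intro add_mono cA cB cD)
      also have "\<dots> = (Suc l choose r) * run_comps r k"
        unfolding Suc by (simp add: algebra_simps)
      finally show ?thesis using fin sub finite_subset by blast
    qed
  qed
  then show "finite (codes l k r)" "card (codes l k r) \<le> (l choose r) * run_comps r k" by auto
qed

definition words :: "nat \<Rightarrow> nat \<Rightarrow> nat \<Rightarrow> step list set" where
  "words n k r = {u. isolated u \<and> p_steps u = n - 1 \<and> q_steps u = n - 1 \<and> shared_steps u = k \<and> runs u = r}"

definition balanced :: "nat \<Rightarrow> step list set" where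
  "balanced m = {v. set v \<subseteq> {OnlyP, OnlyQ} \<and> length v = 2 * m \<and> length (filter (\<lambda>x. x = OnlyP) v) = m}"

lemma finite_balanced: "finite (balanced m)"
  and card_balanced: "card (balanced m) \<le> (2 * m) choose m"
proof -
  have fin: "finite {X. X \<subseteq> {..<2 * m} \<and> card X = m}"
    by (rule finite_subset[of _ "Pow {..<2 * m}"]) auto
  define f where "f v = {i. i < 2 * m \<and> v ! i = OnlyP}" for v :: "step list"
  have inj: "inj_on f (balanced m)"
  proof (rule inj_onI)
    fix v w assume a: "v \<in> balanced m" "w \<in> balanced m" "f v = f w"
    have "v ! i = w ! i" if i: "i < 2 * m" for i
    proof -
      have "v ! i \<in> {OnlyP, OnlyQ}" "w ! i \<in> {OnlyP, OnlyQ}"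
        using a i nth_mem[of i v] nth_mem[of i w] unfolding balanced_def
        by (metis (mono_tags, lifting) mem_Collect_eq subsetD)+
      moreover have "v ! i = OnlyP \<longleftrightarrow> w ! i = OnlyP" using a(3) i by (auto simp: f_def)
      ultimately show ?thesis by auto
    qed
    then show "v = w" using a by (auto simp: balanced_def intro: nth_equalityI)
  qed
  have img: "f ` balanced m \<subseteq> {X. X \<subseteq> {..<2 * m} \<and> card X = m}"
    by (auto simp: f_def balanced_def length_filter_conv_card)
  show "finite (balanced m)" using inj img fin by (metis finite_imageD finite_subset)
  show "card (balanced m) \<le> (2 * m) choose m"
    using card_inj_on_le[OF inj img fin] n_subsets[of "{..<2 * m}" m] by simp
qed

text \<open>Removing the shared letters leaves n - 1 - k letters of each remaining kind, with 2 (n -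
  1 - k) + 1 gaps for the runs.\<close>

lemma finite_words: "finite (words n k r)"
  and card_words: "k < n \<Longrightarrow> card (words n k r) \<le>
    ((2 * (n - 1 - k)) choose (n - 1 - k)) * (((2 * (n - 1 - k) + 1) choose r) * run_comps r k)"
proof -
  let ?m = "n - 1 - k"
  have sub: "words n k r \<subseteq> (\<Union>v\<in>balanced ?m. weave v ` codes (Suc (2 * ?m)) k r)"
  proof
    fix u assume u: "u \<in> words n k r"
    let ?v = "filter (\<lambda>x. \<not> shared x) u"
    have A: "length (filter (\<lambda>x. x = OnlyP) ?v) + shared_steps u = p_steps u"
      unfolding shared_steps_def p_steps_def
      by (induction u) (auto simp: shared_def, (case_tac a; simp)+)
    have B: "length ?v + shared_steps u = length u"
      unfolding shared_steps_def by (induction u) auto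
    have S: "set ?v \<subseteq> {OnlyP, OnlyQ}"
    proof
      fix x assume "x \<in> set ?v"
      then have "\<not> shared x" by simp
      then show "x \<in> {OnlyP, OnlyQ}" by (cases x) auto
    qed
    have "?v \<in> balanced ?m"
      using u A B S length_word[of u] by (auto simp: balanced_def words_def)
    moreover obtain g where "g \<in> codes (Suc (length ?v)) (shared_steps u) (runs u)" "u = weave ?v g"
      using isolated_weave[of u] u by (auto simp: words_def)
    moreover have "length ?v = 2 * ?m" "shared_steps u = k" "runs u = r"
      using u calculation(1) by (auto simp: words_def balanced_def)
    ultimately show "u \<in> (\<Union>v\<in>balanced ?m. weave v ` codes (Suc (2 * ?m)) k r)"
      by (metis UN_I imageI)
  qed
  show "finite (words n k r)"
    using finite_balanced finite_codes by (intro finite_subset[OF sub]) auto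
  have "card (words n k r) \<le> card (\<Union>v\<in>balanced ?m. weave v ` codes (Suc (2 * ?m)) k r)"
    using finite_balanced finite_codes by (intro card_mono[OF _ sub]) auto
  also have "\<dots> \<le> ((2 * ?m) choose ?m) * (((2 * ?m + 1) choose r) * run_comps r k)"
    using card_codes[of "Suc (2 * ?m)" k r]
    by (intro card_UN_le_mult finite_balanced card_balanced order.trans[OF card_image_le[OF finite_codes]]) simp
  finally show "card (words n k r) \<le>
    ((2 * ?m) choose ?m) * (((2 * ?m + 1) choose r) * run_comps r k)" .
qed

section \<open>Moments of the number of increasing paths\<close>

lemma p_steps_simps [simp]:
  "p_steps [] = 0" "p_steps (OnlyP # u) = Suc (p_steps u)" "p_steps (OnlyQ # u) = p_steps u"
  "p_steps (Fwd # u) = Suc (p_steps u)" "p_steps (Rev # u) = Suc (p_steps u)"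
  by (simp_all add: p_steps_def)

lemma q_steps_simps [simp]:
  "q_steps [] = 0" "q_steps (OnlyP # u) = q_steps u" "q_steps (OnlyQ # u) = Suc (q_steps u)"
  "q_steps (Fwd # u) = Suc (q_steps u)" "q_steps (Rev # u) = Suc (q_steps u)"
  by (simp_all add: q_steps_def)

section \<open>Merging two increasing paths into a word\<close>

lemma set_merged_subset:
  "set (merged \<tau> i j u) \<subseteq>
    (\<lambda>i. {i, Suc i}) ` {i..<i + p_steps u} \<union> (\<lambda>j. {\<tau> j, \<tau> (Suc j)}) ` {j..<j + q_steps u}"
proof -
  have ivl: "{i..<Suc (i + m)} = insert i {Suc i..<Suc (i + m)}" for i m :: nat
    by auto
  show ?thesis by (induction \<tau> i j u rule: merged.induct) (auto simp: ivl)
qed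

text \<open>The invariant of a merge resumed after \<open>i\<close> edges of P and \<open>j\<close>
  edges of Q. Its last conjunct bounds all later labels below by one of the two next edges, which
  keeps the list sorted when a letter is prepended.\<close>

definition merges :: "(nat set \<Rightarrow> nat) \<Rightarrow> (nat \<Rightarrow> nat) \<Rightarrow> nat \<Rightarrow> nat \<Rightarrow> nat \<Rightarrow> step list \<Rightarrow> bool" where
  "merges F \<tau> m i j u \<longleftrightarrow>
    i + p_steps u = m \<and> j + q_steps u = m \<and> (\<forall>(a, b) \<in> agreement i j u. \<tau> a = b) \<and>
    sorted_wrt (<) (map F (merged \<tau> i j u)) \<and>
    (\<forall>X \<in> set (merged \<tau> i j u). i < m \<and> F {i, Suc i} \<le> F X \<or> j < m \<and> F {\<tau> j, \<tau> (Suc j)} \<le> F X)"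

text \<open>The merge of merge sort: the smaller of the two next labels comes first. Equal labels
  mean equal edges by injectivity, and the two ways to match the endpoints are \<open>Fwd\<close>
  and \<open>Rev\<close>.\<close>

lemma merges_exists:
  fixes F :: "nat set \<Rightarrow> nat"
  assumes inj: "inj_on F {e. e \<subseteq> {..m} \<and> card e = 2}" and \<tau>: "\<tau> ` {..m} \<subseteq> {..m}" "inj_on \<tau> {..m}"
    and P: "\<And>i. Suc i < m \<Longrightarrow> F {i, Suc i} < F {Suc i, Suc (Suc i)}"
    and Q: "\<And>j. Suc j < m \<Longrightarrow> F {\<tau> j, \<tau> (Suc j)} < F {\<tau> (Suc j), \<tau> (Suc (Suc j))}"
    and ij: "i \<le> m" "j \<le> m"
  shows "\<exists>u. merges F \<tau> m i j u"
  using ij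
proof (induction "(m - i) + (m - j)" arbitrary: i j rule: less_induct)
  case less
  let ?E = "\<lambda>i. {i, Suc i}" and ?D = "\<lambda>j. {\<tau> j, \<tau> (Suc j)}"
  consider "i = m" "j = m" | "i < m" "j = m \<or> F (?E i) < F (?D j)" | "j < m" "i = m \<or> F (?D j) < F (?E i)"
    | "i < m" "j < m" "F (?E i) = F (?D j)"
    using less.prems by linarith
  then show ?case
  proof cases
    case 1
    then show ?thesis by (intro exI[of _ "[]"]) (simp add: merges_def)
  next
    case 2
    have "\<exists>u. merges F \<tau> m (Suc i) j u" using 2 less.prems by (intro less.hyps) auto
    then obtain u where u: "merges F \<tau> m (Suc i) j u" by blast
    have lt: "F (?E i) < F X" if "X \<in> set (merged \<tau> (Suc i) j u)" for X
    proof -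
      have "Suc i < m \<and> F (?E (Suc i)) \<le> F X \<or> j < m \<and> F (?D j) \<le> F X"
        using u that by (simp add: merges_def)
      then show ?thesis using 2 P[of i] by linarith
    qed
    have "merges F \<tau> m i j (OnlyP # u)"
      unfolding merges_def using u[unfolded merges_def] 2 lt less_imp_le[OF lt] by simp
    then show ?thesis by blast
  next
    case 3
    have "\<exists>u. merges F \<tau> m i (Suc j) u" using 3 less.prems by (intro less.hyps) auto
    then obtain u where u: "merges F \<tau> m i (Suc j) u" by blast
    have lt: "F (?D j) < F X" if "X \<in> set (merged \<tau> i (Suc j) u)" for X
    proof -
      have "i < m \<and> F (?E i) \<le> F X \<or> Suc j < m \<and> F (?D (Suc j)) \<le> F X"
        using u that by (simp add: merges_def)
      then show ?thesis using 3 Q[of j] by linarith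
    qed
    have "merges F \<tau> m i j (OnlyQ # u)"
      unfolding merges_def using u[unfolded merges_def] 3 lt less_imp_le[OF lt] by simp
    then show ?thesis by blast
  next
    case 4
    have "\<exists>u. merges F \<tau> m (Suc i) (Suc j) u" using 4 less.prems by (intro less.hyps) auto
    then obtain u where u: "merges F \<tau> m (Suc i) (Suc j) u" by blast
    have "\<tau> j \<noteq> \<tau> (Suc j)" "\<tau> j \<le> m" "\<tau> (Suc j) \<le> m"
      using inj_onD[OF \<tau>(2), of j "Suc j"] \<tau>(1) 4 by (auto simp: image_subset_iff)
    then have "?E i = ?D j" using 4 inj_onD[OF inj, of "?E i" "?D j"] by simp
    then consider "\<tau> j = i" "\<tau> (Suc j) = Suc i" | "\<tau> j = Suc i" "\<tau> (Suc j) = i"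
      by (auto simp: doubleton_eq_iff)
    moreover have lt: "F (?E i) < F X" if "X \<in> set (merged \<tau> (Suc i) (Suc j) u)" for X
    proof -
      have "Suc i < m \<and> F (?E (Suc i)) \<le> F X \<or> Suc j < m \<and> F (?D (Suc j)) \<le> F X"
        using u that by (simp add: merges_def)
      then show ?thesis using 4 P[of i] Q[of j] by linarith
    qed
    ultimately show ?thesis
    proof cases
      case 1
      then have "merges F \<tau> m i j (Fwd # u)"
        unfolding merges_def using u[unfolded merges_def] 4 lt less_imp_le[OF lt] by simp
      then show ?thesis by blast
    next
      case 2
      then have "merges F \<tau> m i j (Rev # u)"
        unfolding merges_def using u[unfolded merges_def] 4 lt less_imp_le[OF lt] by simp
      then show ?thesis by blast
    qed
  qed
qed

section \<open>Bijections increasing along a list\<close>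

definition sorted_bijections :: "'a set \<Rightarrow> nat set \<Rightarrow> 'a list \<Rightarrow> ('a \<Rightarrow> nat) set" where
  "sorted_bijections A B L = {f \<in> bijections A B. sorted_wrt (<) (map f L)}"

text \<open>Composing with a permutation of \<open>A\<close> that carries \<open>L\<close> to
  \<open>L'\<close> entry by entry is an injection.\<close>

lemma card_sorted_bijections_le:
  assumes A: "finite A" "finite B" and L: "distinct L" "distinct L'" "set L = set L'" "set L \<subseteq> A"
  shows "card (sorted_bijections A B L') \<le> card (sorted_bijections A B L)"
proof -
  have len: "length L = length L'" using L distinct_card by metis
  define \<pi> where "\<pi> x = (if x \<in> set L then L' ! inv_into {..<length L} ((!) L) x else x)" for x
  have "bij_betw ((!) L) {..<length L} (set L)" "bij_betw ((!) L') {..<length L} (set L)"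
    using L len by (auto intro: bij_betw_nth)
  then have "bij_betw ((!) L' \<circ> inv_into {..<length L} ((!) L)) (set L) (set L)"
    by (intro bij_betw_trans[OF bij_betw_inv_into])
  then have "bij_betw \<pi> (set L) (set L)"
    by (rule bij_betw_cong[THEN iffD1, rotated]) (simp add: \<pi>_def)
  moreover have "bij_betw \<pi> (A - set L) (A - set L)"
    by (rule bij_betw_cong[THEN iffD2, OF _ bij_betw_id]) (simp add: \<pi>_def)
  ultimately have "bij_betw \<pi> (set L \<union> (A - set L)) (set L \<union> (A - set L))"
    by (rule bij_betw_combine) auto
  then have \<pi>: "bij_betw \<pi> A A" using L by (simp add: Un_absorb1)
  have out: "\<pi> x = x" if "x \<notin> A" for x using that L by (auto simp: \<pi>_def)
  have map\<pi>: "map \<pi> L = L'"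
  proof (rule nth_equalityI)
    fix i assume "i < length (map \<pi> L)"
    then have i: "i < length L" by simp
    have "inj_on ((!) L) {..<length L}" using L by (auto simp: inj_on_def nth_eq_iff_index_eq)
    then show "map \<pi> L ! i = L' ! i" using i by (simp add: \<pi>_def inv_into_f_f)
  qed (simp add: len)
  show ?thesis
  proof (rule card_inj_on_le[where f = "\<lambda>f. f \<circ> \<pi>"])
    show "inj_on (\<lambda>f. f \<circ> \<pi>) (sorted_bijections A B L')"
    proof (rule inj_onI, rule ext)
      fix f g x assume fg: "f \<in> sorted_bijections A B L'" "g \<in> sorted_bijections A B L'" "f \<circ> \<pi> = g \<circ> \<pi>"
      show "f x = g x"
      proof (cases "x \<in> A")
        case True
        then obtain y where "x = \<pi> y" using \<pi> by (auto simp: bij_betw_def)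
        then show ?thesis using fun_cong[OF fg(3), of y] by simp
      next
        case False
        then show ?thesis using fun_cong[OF fg(3), of x] out by simp
      qed
    qed
    show "(\<lambda>f. f \<circ> \<pi>) ` sorted_bijections A B L' \<subseteq> sorted_bijections A B L"
    proof clarify
      fix f assume f: "f \<in> sorted_bijections A B L'"
      have "bij_betw (f \<circ> \<pi>) A B"
        using f by (intro bij_betw_trans[OF \<pi>]) (simp add: sorted_bijections_def bijections_def)
      moreover have "f \<circ> \<pi> \<in> extensional A"
        using f out by (auto simp: sorted_bijections_def bijections_def extensional_def)
      moreover have "map (f \<circ> \<pi>) L = map f L'" using map\<pi> by (metis map_map)
      ultimately show "f \<circ> \<pi> \<in> sorted_bijections A B L"
        using f by (simp add: sorted_bijections_def bijections_def)
    qed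
    show "finite (sorted_bijections A B L)"
      using finite_bijections[OF A] by (simp add: sorted_bijections_def)
  qed
qed

lemma ex1_sorted_permutation:
  fixes f :: "'a \<Rightarrow> nat"
  assumes S: "finite S" and f: "inj_on f S"
  shows "card {L \<in> permutations_of_set S. sorted_wrt (<) (map f L)} = 1"
proof -
  define M where "M = map (inv_into S f) (sorted_list_of_set (f ` S))"
  have mem: "set (sorted_list_of_set (f ` S)) = f ` S" using S by simp
  have "map f M = map id (sorted_list_of_set (f ` S))"
    unfolding M_def map_map by (rule map_cong) (use mem in \<open>auto simp: f_inv_into_f\<close>)
  then have fM: "map f M = sorted_list_of_set (f ` S)" by simp
  have "distinct M" using fM distinct_sorted_list_of_set by (metis distinct_map)
  moreover have "set M = S" unfolding M_def set_map mem using f by (simp add: image_comp inv_into_image_cancel)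
  ultimately have "M \<in> permutations_of_set S" by (simp add: permutations_of_set_def)
  moreover have "sorted_wrt (<) (map f M)" unfolding fM by simp
  moreover have "L = M" if "L \<in> permutations_of_set S" "sorted_wrt (<) (map f L)" for L
  proof -
    have L: "set L = S" using that by (simp add: permutations_of_set_def)
    have "map f L = sorted_list_of_set (f ` S)"
      using that L S by (metis list.set_map sorted_list_of_set.idem_if_sorted_distinct strict_sorted_iff)
    then have "map f L = map f M" using fM by simp
    then show ?thesis using f L \<open>set M = S\<close> by (metis map_inj_on sup.idem)
  qed
  ultimately have "{L \<in> permutations_of_set S. sorted_wrt (<) (map f L)} = {M}" by blast
  then show ?thesis by simp
qed

text \<open>Each bijection is increasing along exactly one ordering of \<open>set L\<close>, and by
  symmetry all orderings receive equally many bijections.\<close>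

lemma card_sorted_bijections:
  assumes A: "finite A" "finite B" and L: "distinct L" "set L \<subseteq> A"
  shows "card (sorted_bijections A B L) * fact (length L) = card (bijections A B)"
proof -
  let ?S = "permutations_of_set (set L)"
  have "card (bijections A B) = (\<Sum>f\<in>bijections A B. card {M \<in> ?S. sorted_wrt (<) (map f M)})"
    using L by (subst sum.cong[OF refl ex1_sorted_permutation])
      (auto simp: bijections_def bij_betw_def intro: inj_on_subset)
  also have "\<dots> = (\<Sum>f\<in>bijections A B. \<Sum>M\<in>?S. if sorted_wrt (<) (map f M) then 1 else 0)"
    by (simp add: sum.If_cases Int_def)
  also have "\<dots> = (\<Sum>M\<in>?S. \<Sum>f\<in>bijections A B. if sorted_wrt (<) (map f M) then 1 else 0)"
    by (rule sum.swap)
  also have "\<dots> = (\<Sum>M\<in>?S. card (sorted_bijections A B M))"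
    using finite_bijections[OF A] by (simp add: sum.If_cases Int_def sorted_bijections_def)
  also have "\<dots> = (\<Sum>M\<in>?S. card (sorted_bijections A B L))"
  proof (intro sum.cong refl antisym)
    fix M assume "M \<in> ?S"
    then have "distinct M" "set M = set L" by (auto simp: permutations_of_set_def)
    then show "card (sorted_bijections A B M) \<le> card (sorted_bijections A B L)"
      "card (sorted_bijections A B L) \<le> card (sorted_bijections A B M)"
      using A L by (auto intro: card_sorted_bijections_le)
  qed
  also have "\<dots> = card (sorted_bijections A B L) * fact (length L)"
    using L by (simp add: distinct_card mult.commute)
  finally show ?thesis by simp
qed


section \<open>Increasing Hamiltonian paths and their pairs\<close>

definition paths :: "nat \<Rightarrow> nat list set" where
  "paths n = permutations_of_set {1..n}"

text \<open>Comparing all pairs of labels is equivalent to comparing successive ones, by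
  transitivity, and is the form in which \<open>sorted_bijections\<close> counts.\<close>

definition increasing_on :: "(nat set \<Rightarrow> nat) \<Rightarrow> nat list \<Rightarrow> bool" where
  "increasing_on f p \<longleftrightarrow> sorted_wrt (<) (map f (path_edges p))"

lemma path_edges_eq: "path_edges p = map (\<lambda>i. {p ! i, p ! Suc i}) [0..<length p - 1]"
  unfolding path_edges_def
  by (rule nth_equalityI) (auto simp: nth_tl)

lemma pathsD:
  assumes "p \<in> paths n"
  shows "distinct p" "set p = {1..n}" "length p = n"
  using assms distinct_card[of p] by (auto simp: paths_def permutations_of_set_def)

lemma finite_paths [simp]: "finite (paths n)" and card_paths [simp]: "card (paths n) = fact n"
  by (simp_all add: paths_def)

lemma edge_orderings_eq: "edge_orderings n = bijections (edges n) {1..n choose 2}"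
  by (auto simp: edge_orderings_def bijections_def)

lemma path_image:
  assumes p: "p \<in> paths n"
  shows "inj_on ((`) ((!) p)) (Pow {..<n})" "e \<subseteq> {..<n} \<Longrightarrow> card e = 2 \<Longrightarrow> (!) p ` e \<in> edges n"
proof -
  have inj: "inj_on ((!) p) {..<n}" and img: "(!) p ` {..<n} = {1..n}"
    using pathsD[OF p] bij_betw_nth[of p "{..<n}" "{1..n}"] by (auto simp: bij_betw_def)
  then show "inj_on ((`) ((!) p)) (Pow {..<n})" by (simp add: inj_on_image_Pow)
  show "(!) p ` e \<in> edges n" if "e \<subseteq> {..<n}" "card e = 2"
    using that inj img by (auto simp: edges_def verts_def card_image inj_on_subset)
qed

lemma path_edges_distinct:
  assumes p: "p \<in> paths n" and n: "n > 0"
  shows "distinct (path_edges p)" "set (path_edges p) \<subseteq> edges n" "length (path_edges p) = n - 1"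
proof -
  have "distinct (map (\<lambda>i. {i, Suc i}) [0..<n - 1])"
    by (auto simp: distinct_map inj_on_def doubleton_eq_iff)
  then have "distinct (map ((`) ((!) p)) (map (\<lambda>i. {i, Suc i}) [0..<n - 1]))"
    by (subst distinct_map) (auto intro!: inj_on_subset[OF path_image(1)[OF p]])
  then show "distinct (path_edges p)" using pathsD[OF p] by (simp add: path_edges_eq comp_def)
  have "(!) p ` {i, Suc i} \<in> edges n" if "i < n - 1" for i
    using that by (intro path_image(2)[OF p]) auto
  then show "set (path_edges p) \<subseteq> edges n" using pathsD[OF p] by (auto simp: path_edges_eq)
qed (use pathsD[OF p] in \<open>simp add: path_edges_eq\<close>)

lemma real_eq_div_fact:
  assumes "a * fact m = c"
  shows "real a = real c / fact m"
proof -
  have "real c = real a * fact m" unfolding assms[symmetric] by simp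
  then show ?thesis by simp
qed

lemma card_increasing:
  assumes p: "p \<in> paths n" and n: "n > 0"
  shows "card {f \<in> edge_orderings n. increasing_on f p} * fact (n - 1) = card (edge_orderings n)"
  using card_sorted_bijections[OF finite_edges _ path_edges_distinct(1,2)[OF p n], of "{1..n choose 2}"]
    path_edges_distinct(3)[OF p n]
  by (simp add: edge_orderings_eq sorted_bijections_def increasing_on_def)

definition describing :: "nat \<Rightarrow> step list \<Rightarrow> (nat \<Rightarrow> nat) set" where
  "describing n u = {\<tau> \<in> bijections {..<n} {..<n}. describes n \<tau> u}"

text \<open>Pulling \<open>f\<close> back along \<open>p\<close> turns P into the path 0, 1, ..., n
  - 1 and Q into \<tau>, where \<open>merges_exists\<close> applies.\<close>

lemma increasing_pair_described:
  assumes p: "p \<in> paths n" and \<tau>: "\<tau> \<in> bijections {..<n} {..<n}" and n: "n > 0"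
    and f: "f \<in> edge_orderings n" and inc: "increasing_on f p" "increasing_on f (map (\<lambda>j. p ! \<tau> j) [0..<n])"
  shows "\<exists>u. describes n \<tau> u \<and> f \<in> sorted_bijections (edges n) {1..n choose 2} (map ((`) ((!) p)) (merged \<tau> 0 0 u))"
proof -
  define F where "F X = f ((!) p ` X)" for X
  define m where "m = n - 1"
  have m: "{..m} = {..<n}" using n by (auto simp: m_def)
  have \<tau>': "inj_on \<tau> {..<n}" "\<tau> ` {..<n} = {..<n}" using \<tau> by (auto simp: bijections_def bij_betw_def)
  have len: "length p = n" using pathsD[OF p] by simp
  have finj: "inj_on f (edges n)" using f by (auto simp: edge_orderings_eq bijections_def bij_betw_def)
  have inj: "inj_on F {e. e \<subseteq> {..m} \<and> card e = 2}"
    using path_image[OF p] finj unfolding m F_def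
    by (auto simp: inj_on_def)
  have P: "F {i, Suc i} < F {Suc i, Suc (Suc i)}" if "Suc i < m" for i
    using inc(1) that len unfolding increasing_on_def sorted_wrt_iff_nth_less
    by (force simp: path_edges_eq F_def m_def)
  have Q: "F {\<tau> j, \<tau> (Suc j)} < F {\<tau> (Suc j), \<tau> (Suc (Suc j))}" if "Suc j < m" for j
  proof -
    let ?q = "map (\<lambda>j. p ! \<tau> j) [0..<n]"
    have "\<forall>i j. i < j \<longrightarrow> j < n - 1 \<longrightarrow> map f (path_edges ?q) ! i < map f (path_edges ?q) ! j"
      using inc(2) by (simp add: increasing_on_def sorted_wrt_iff_nth_less path_edges_eq)
    then have "map f (path_edges ?q) ! j < map f (path_edges ?q) ! Suc j"
      using that by (simp add: m_def)
    moreover have "j < n" "Suc j < n" "Suc (Suc j) < n" using that by (auto simp: m_def)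
    ultimately show ?thesis using that by (simp add: path_edges_eq F_def m_def)
  qed
  have "\<exists>u. merges F \<tau> m 0 0 u"
    by (rule merges_exists[OF inj]) (use \<tau>' P Q in \<open>auto simp: m\<close>)
  then obtain u where u: "merges F \<tau> m 0 0 u" by blast
  then have s: "sorted_wrt (<) (map F (merged \<tau> 0 0 u))" by (simp add: merges_def)
  then have "distinct (merged \<tau> 0 0 u)" using strict_sorted_iff distinct_map by blast
  then have "describes n \<tau> u" using u by (simp add: merges_def describes_def m_def)
  moreover have "map F (merged \<tau> 0 0 u) = map f (map ((`) ((!) p)) (merged \<tau> 0 0 u))"
    by (simp add: F_def)
  ultimately show ?thesis using s f by (metis (mono_tags, lifting) edge_orderings_eq mem_Collect_eq sorted_bijections_def)
qed

lemma card_merged_orderings: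
  assumes p: "p \<in> paths n" and \<tau>: "\<tau> \<in> bijections {..<n} {..<n}" and n: "n > 0"
    and u: "describes n \<tau> u"
  shows "card (sorted_bijections (edges n) {1..n choose 2} (map ((`) ((!) p)) (merged \<tau> 0 0 u))) * fact (length u)
    = card (edge_orderings n)"
proof -
  have \<tau>': "inj_on \<tau> {..<n}" "\<tau> ` {..<n} = {..<n}" using \<tau> by (auto simp: bijections_def bij_betw_def)
  have sub: "e \<subseteq> {..<n} \<and> card e = 2" if e: "e \<in> set (merged \<tau> 0 0 u)" for e
  proof -
    have "e \<in> (\<lambda>i. {i, Suc i}) ` {0..<n - 1} \<union> (\<lambda>j. {\<tau> j, \<tau> (Suc j)}) ` {0..<n - 1}"
      using e u set_merged_subset[of \<tau> 0 0 u] by (auto simp: describes_def)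
    then consider i where "i < n - 1" "e = {i, Suc i}" | j where "j < n - 1" "e = {\<tau> j, \<tau> (Suc j)}" by auto
    then show ?thesis
    proof cases
      case (2 j)
      then have "j < n" "Suc j < n" by auto
      then have "\<tau> j < n" "\<tau> (Suc j) < n" "\<tau> j \<noteq> \<tau> (Suc j)"
        using \<tau>'(2) inj_onD[OF \<tau>'(1), of j "Suc j"] by auto
      then show ?thesis using 2 by auto
    qed auto
  qed
  have "distinct (map ((`) ((!) p)) (merged \<tau> 0 0 u))"
    using u sub inj_on_subset[OF path_image(1)[OF p], of "set (merged \<tau> 0 0 u)"]
    by (auto simp: distinct_map describes_def)
  moreover have "set (map ((`) ((!) p)) (merged \<tau> 0 0 u)) \<subseteq> edges n"
    using sub path_image(2)[OF p] by auto
  ultimately show ?thesis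
    using card_sorted_bijections[OF finite_edges, of "{1..n choose 2}" "map ((`) ((!) p)) (merged \<tau> 0 0 u)" n]
    by (simp add: edge_orderings_eq length_merged)
qed

lemma describing_words:
  assumes "\<tau> \<in> bijections {..<n} {..<n}" "describes n \<tau> u" "n > 0"
  shows "\<exists>k<n. \<exists>r\<le>k. u \<in> words n k r"
proof -
  have "shared_steps u < n" using shared_steps_le[of u] assms by (auto simp: describes_def)
  moreover have "u \<in> words n (shared_steps u) (runs u)"
    using card_described_le(2)[OF assms] assms(2) by (simp add: words_def describes_def)
  ultimately show ?thesis using runs_le by blast
qed

text \<open>Every \<open>q\<close> is \<open>p\<close> read in some order \<tau>. For each \<tau> a
  union bound runs over the describing words, and a word has length 2 (n - 1) - k because shared
  letters serve both paths.\<close>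

lemma card_increasing_pairs:
  assumes p: "p \<in> paths n" and n: "n > 0"
  shows "(\<Sum>q\<in>paths n. real (card {f \<in> edge_orderings n. increasing_on f p \<and> increasing_on f q}))
    \<le> (\<Sum>k<n. \<Sum>r\<le>k. \<Sum>u\<in>words n k r. real (card (describing n u)) * (card (edge_orderings n) / fact (2 * (n - 1) - k)))"
proof -
  let ?T = "bijections {..<n} {..<n}" and ?q = "\<lambda>\<tau>. map (\<lambda>j. p ! \<tau> j) [0..<n]"
  let ?c = "\<lambda>q. real (card {f \<in> edge_orderings n. increasing_on f p \<and> increasing_on f q})"
  have finT: "finite ?T" by (intro finite_bijections) auto
  have "paths n \<subseteq> ?q ` ?T"
  proof
    fix q assume q: "q \<in> paths n"
    have "bij_betw ((!) p) {..<n} {1..n}" "bij_betw ((!) q) {..<n} {1..n}"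
      using pathsD[OF p] pathsD[OF q] by (auto intro: bij_betw_nth)
    then have b: "bij_betw (inv_into {..<n} ((!) p) \<circ> (!) q) {..<n} {..<n}"
      by (meson bij_betw_inv_into bij_betw_trans)
    define \<tau> where "\<tau> = restrict (inv_into {..<n} ((!) p) \<circ> (!) q) {..<n}"
    have "\<tau> \<in> ?T" using b by (simp add: \<tau>_def bijections_def bij_betw_restrict_eq)
    moreover have "q = ?q \<tau>"
    proof (rule nth_equalityI)
      fix j assume j: "j < length q"
      then have "q ! j \<in> (!) p ` {..<n}"
        using pathsD[OF q] \<open>bij_betw ((!) p) {..<n} {1..n}\<close> nth_mem[OF j] by (auto simp: bij_betw_def)
      then show "q ! j = ?q \<tau> ! j" using j pathsD[OF q] by (simp add: \<tau>_def f_inv_into_f)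
    qed (use pathsD[OF q] in simp)
    ultimately show "q \<in> ?q ` ?T" by blast
  qed
  then have "(\<Sum>q\<in>paths n. ?c q) \<le> (\<Sum>q\<in>?q ` ?T. ?c q)"
    using finT by (intro sum_mono2) auto
  also have "\<dots> \<le> (\<Sum>\<tau>\<in>?T. ?c (?q \<tau>))"
    using finT by (intro order.trans[OF sum_image_le[where g = ?c]]) auto
  also have "\<dots> \<le> (\<Sum>\<tau>\<in>?T. \<Sum>k<n. \<Sum>r\<le>k. \<Sum>u\<in>{u \<in> words n k r. describes n \<tau> u}. card (edge_orderings n) / fact (2 * (n - 1) - k))"
  proof (rule sum_mono)
    fix \<tau> assume \<tau>: "\<tau> \<in> ?T"
    let ?S = "\<lambda>u. sorted_bijections (edges n) {1..n choose 2} (map ((`) ((!) p)) (merged \<tau> 0 0 u))"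
    let ?W = "\<lambda>k r. {u \<in> words n k r. describes n \<tau> u}"
    have finS: "finite (?S u)" for u
      using finite_bijections[OF finite_edges, of "{1..n choose 2}" n] by (simp add: sorted_bijections_def)
    have "{f \<in> edge_orderings n. increasing_on f p \<and> increasing_on f (?q \<tau>)} \<subseteq> (\<Union>k<n. \<Union>r\<le>k. \<Union>u\<in>?W k r. ?S u)"
    proof
      fix f assume "f \<in> {f \<in> edge_orderings n. increasing_on f p \<and> increasing_on f (?q \<tau>)}"
      then obtain u where u: "describes n \<tau> u" "f \<in> ?S u" using increasing_pair_described[OF p \<tau> n] by blast
      then obtain k r where "k < n" "r \<le> k" "u \<in> words n k r" using describing_words[OF \<tau> _ n] by blast
      then show "f \<in> (\<Union>k<n. \<Union>r\<le>k. \<Union>u\<in>?W k r. ?S u)" using u by blast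
    qed
    then have "card {f \<in> edge_orderings n. increasing_on f p \<and> increasing_on f (?q \<tau>)} \<le> card (\<Union>k<n. \<Union>r\<le>k. \<Union>u\<in>?W k r. ?S u)"
      using finS finite_words by (intro card_mono) auto
    also have "\<dots> \<le> (\<Sum>k<n. card (\<Union>r\<le>k. \<Union>u\<in>?W k r. ?S u))" by (rule card_UN_le) simp
    also have "\<dots> \<le> (\<Sum>k<n. \<Sum>r\<le>k. card (\<Union>u\<in>?W k r. ?S u))" by (intro sum_mono card_UN_le) simp
    also have "\<dots> \<le> (\<Sum>k<n. \<Sum>r\<le>k. \<Sum>u\<in>?W k r. card (?S u))"
      using finite_words by (intro sum_mono card_UN_le) simp
    finally have "?c (?q \<tau>) \<le> (\<Sum>k<n. \<Sum>r\<le>k. \<Sum>u\<in>?W k r. real (card (?S u)))"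
      by (simp only: of_nat_sum[symmetric] of_nat_le_iff)
    also have "\<dots> = (\<Sum>k<n. \<Sum>r\<le>k. \<Sum>u\<in>?W k r. card (edge_orderings n) / fact (2 * (n - 1) - k))"
    proof (intro sum.cong refl)
      fix k r u assume "u \<in> ?W k r"
      then have u: "u \<in> words n k r" "describes n \<tau> u" by auto
      have "length u = 2 * (n - 1) - k" using u length_word[of u] by (auto simp: words_def)
      then show "real (card (?S u)) = card (edge_orderings n) / fact (2 * (n - 1) - k)"
        using real_eq_div_fact[OF card_merged_orderings[OF p \<tau> n u(2)]] by simp
    qed
    finally show "?c (?q \<tau>) \<le> (\<Sum>k<n. \<Sum>r\<le>k. \<Sum>u\<in>?W k r. card (edge_orderings n) / fact (2 * (n - 1) - k))" .
  qed
  also have "\<dots> = (\<Sum>\<tau>\<in>?T. \<Sum>k<n. \<Sum>r\<le>k. \<Sum>u\<in>words n k r. if describes n \<tau> u then card (edge_orderings n) / fact (2 * (n - 1) - k) else 0)"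
    by (intro sum.cong refl sum.inter_filter finite_words)
  also have "\<dots> = (\<Sum>k<n. \<Sum>r\<le>k. \<Sum>u\<in>words n k r. \<Sum>\<tau>\<in>?T. if describes n \<tau> u then card (edge_orderings n) / fact (2 * (n - 1) - k) else 0)"
    by (subst sum.swap, intro sum.cong refl, subst sum.swap, intro sum.cong refl, rule sum.swap)
  also have "\<dots> = (\<Sum>k<n. \<Sum>r\<le>k. \<Sum>u\<in>words n k r. real (card (describing n u)) * (card (edge_orderings n) / fact (2 * (n - 1) - k)))"
    by (intro sum.cong refl, subst sum.inter_filter[OF finT, symmetric]) (simp add: describing_def)
  finally show ?thesis .
qed

definition path_count :: "nat \<Rightarrow> (nat set \<Rightarrow> nat) \<Rightarrow> nat" where
  "path_count n f = card {p \<in> paths n. increasing_on f p}"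

lemma path_count_eq: "real (path_count n f) = (\<Sum>p\<in>paths n. if increasing_on f p then 1 else 0)"
  by (simp add: path_count_def sum.If_cases Int_def)

lemma first_moment:
  assumes "n > 0"
  shows "(\<Sum>f\<in>edge_orderings n. real (path_count n f)) = n * card (edge_orderings n)"
proof -
  have "(\<Sum>f\<in>edge_orderings n. real (path_count n f)) =
    (\<Sum>p\<in>paths n. \<Sum>f\<in>edge_orderings n. if increasing_on f p then 1 else 0)"
    unfolding path_count_eq by (rule sum.swap)
  also have "\<dots> = (\<Sum>p\<in>paths n. real (card {f \<in> edge_orderings n. increasing_on f p}))"
    using finite_edge_orderings by (simp add: sum.If_cases Int_def)
  also have "\<dots> = (\<Sum>p\<in>paths n. card (edge_orderings n) / fact (n - 1))"
    by (intro sum.cong refl real_eq_div_fact card_increasing assms)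
  also have "\<dots> = n * card (edge_orderings n)"
    using assms by (simp add: fact_reduce)
  finally show ?thesis .
qed

lemma second_moment:
  assumes n: "n > 0"
  shows "(\<Sum>f\<in>edge_orderings n. (real (path_count n f))\<^sup>2) \<le> card (edge_orderings n) *
    (fact n * (\<Sum>k<n. \<Sum>r\<le>k. \<Sum>u\<in>words n k r. card (describing n u) / fact (2 * (n - 1) - k)))"
proof -
  let ?\<Omega> = "edge_orderings n"
  have sq: "(real (path_count n f))\<^sup>2 =
      (\<Sum>p\<in>paths n. \<Sum>q\<in>paths n. if increasing_on f p \<and> increasing_on f q then 1 else 0)" for f
    unfolding path_count_eq power2_eq_square sum_product by (intro sum.cong refl) auto
  have "(\<Sum>f\<in>?\<Omega>. (real (path_count n f))\<^sup>2) =
     (\<Sum>p\<in>paths n. \<Sum>q\<in>paths n. \<Sum>f\<in>?\<Omega>. if increasing_on f p \<and> increasing_on f q then 1 else 0)"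
    unfolding sq by (subst sum.swap, intro sum.cong refl, rule sum.swap)
  also have "\<dots> = (\<Sum>p\<in>paths n. \<Sum>q\<in>paths n. real (card {f \<in> ?\<Omega>. increasing_on f p \<and> increasing_on f q}))"
    using finite_edge_orderings by (simp add: sum.If_cases Int_def)
  also have "\<dots> \<le> (\<Sum>p\<in>paths n. \<Sum>k<n. \<Sum>r\<le>k. \<Sum>u\<in>words n k r. real (card (describing n u)) * (card ?\<Omega> / fact (2 * (n - 1) - k)))"
    by (intro sum_mono card_increasing_pairs n)
  also have "\<dots> = card ?\<Omega> * (fact n * (\<Sum>k<n. \<Sum>r\<le>k. \<Sum>u\<in>words n k r. card (describing n u) / fact (2 * (n - 1) - k)))"
    by (simp add: sum_distrib_left mult_ac)
  finally show ?thesis .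
qed

text \<open>Cauchy-Schwarz for X and the indicator of X > 0 gives (E X)^2 \<le> E X^2 * P(X > 0),
  and E X = n.\<close>

lemma prob_ge:
  assumes n: "n > 0"
    and S: "fact n * (\<Sum>k<n. \<Sum>r\<le>k. \<Sum>u\<in>words n k r. card (describing n u) / fact (2 * (n - 1) - k)) \<le> c * n\<^sup>2"
  shows "1 / c \<le> measure_pmf.prob (random_edge_ordering n) {f. \<exists>p. increasing_path n f p \<and> hamiltonian n p}"
proof -
  let ?\<Omega> = "edge_orderings n"
  define A where "A = {f \<in> ?\<Omega>. path_count n f > 0}"
  have A: "?\<Omega> \<inter> {f. \<exists>p. increasing_path n f p \<and> hamiltonian n p} = A"
  proof -
    have "(\<exists>p. increasing_path n f p \<and> hamiltonian n p) \<longleftrightarrow> path_count n f > 0" for f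
    proof -
      have "increasing_path n f p \<and> hamiltonian n p \<longleftrightarrow> p \<in> paths n \<and> increasing_on f p" for p
        using n unfolding increasing_path_def hamiltonian_def simple_path_def increasing_on_def paths_def
          permutations_of_set_def verts_def
        by (auto simp: successively_conv_sorted_wrt)
      then have "(\<exists>p. increasing_path n f p \<and> hamiltonian n p) \<longleftrightarrow> (\<exists>p\<in>paths n. increasing_on f p)"
        by blast
      also have "\<dots> \<longleftrightarrow> path_count n f > 0" by (auto simp: path_count_def card_gt_0_iff)
      finally show ?thesis .
    qed
    then show ?thesis by (auto simp: A_def)
  qed
  have fin: "finite ?\<Omega>" by (rule finite_edge_orderings)
  have pos: "card ?\<Omega> > 0" using edge_orderings_nonempty fin by (simp add: card_gt_0_iff)
  have prob: "measure_pmf.prob (random_edge_ordering n) {f. \<exists>p. increasing_path n f p \<and> hamiltonian n p} = card A / card ?\<Omega>"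
    unfolding random_edge_ordering_def using A by (simp add: measure_pmf_of_set[OF edge_orderings_nonempty fin])
  have "(\<Sum>f\<in>?\<Omega>. real (path_count n f)) = (\<Sum>f\<in>A. real (path_count n f) * 1)"
    using fin by (intro sum.mono_neutral_cong_right) (auto simp: A_def)
  then have "(n * card ?\<Omega>)\<^sup>2 \<le> (\<Sum>f\<in>A. (real (path_count n f))\<^sup>2) * (\<Sum>f\<in>A. 1\<^sup>2)"
    using Cauchy_Schwarz_ineq_sum[of "\<lambda>f. real (path_count n f)" "\<lambda>_. 1" A] first_moment[OF n] by simp
  also have "\<dots> \<le> (\<Sum>f\<in>?\<Omega>. (real (path_count n f))\<^sup>2) * card A"
    using fin by (auto simp: A_def intro!: mult_right_mono sum_mono2)
  also have "\<dots> \<le> (card ?\<Omega> * (c * n\<^sup>2)) * card A"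
    using S by (intro mult_right_mono order.trans[OF second_moment[OF n]] mult_left_mono) auto
  finally have "(real n)\<^sup>2 * card ?\<Omega> * card ?\<Omega> \<le> (real n)\<^sup>2 * card ?\<Omega> * (c * card A)"
    by (simp add: power2_eq_square algebra_simps)
  then have "card ?\<Omega> \<le> c * card A" using pos n by (simp add: mult_le_cancel_left)
  moreover from this have "c > 0" using pos by (smt (verit) of_nat_0_less_iff of_nat_0_le_iff mult_nonpos_nonneg)
  ultimately show ?thesis unfolding prob using pos by (simp add: field_simps)
qed

section \<open>The second moment bound\<close>

text \<open>Here \<open>c\<close> is the fraction kept of the free bijections: about exp (- 2) for
  small \<open>k\<close>, and 1 in the tail. If k + r > n, subtraction truncates in
  \<open>term_bound\<close>, but then no \<tau> fits the word and the contribution is 0.\<close>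

lemma words_sum_le:
  assumes k: "k < n" and c: "c \<ge> 0"
    and A: "\<And>u. u \<in> words n k r \<Longrightarrow> describing n u \<noteq> {} \<Longrightarrow> k + r \<le> n \<and> real (card (describing n u)) \<le> c * fact (n - k - r)"
  shows "fact n * (\<Sum>u\<in>words n k r. card (describing n u) / fact (2 * (n - 1) - k))
    \<le> (real n)\<^sup>2 * (c * (if k + r \<le> n then term_bound n k r else 0))"
proof (cases "k + r \<le> n")
  case True
  have "real (card (describing n u)) \<le> c * fact (n - k - r)" if "u \<in> words n k r" for u
    using A[OF that] c by (cases "describing n u = {}") auto
  then have "(\<Sum>u\<in>words n k r. card (describing n u) / fact (2 * (n - 1) - k))
      \<le> (\<Sum>u\<in>words n k r. c * fact (n - k - r) / fact (2 * (n - 1) - k))"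
    by (intro sum_mono divide_right_mono) auto
  also have "\<dots> = real (card (words n k r)) * (c * fact (n - k - r) / fact (2 * (n - 1) - k))" by simp
  also have "\<dots> \<le> real (((2 * (n - 1 - k)) choose (n - 1 - k)) * (((2 * (n - 1 - k) + 1) choose r) * run_comps r k))
      * (c * fact (n - k - r) / fact (2 * (n - 1) - k))"
    using c by (intro mult_right_mono of_nat_mono card_words k) auto
  finally have "fact n * (\<Sum>u\<in>words n k r. card (describing n u) / fact (2 * (n - 1) - k)) \<le>
    fact n * (real (((2 * (n - 1 - k)) choose (n - 1 - k)) * (((2 * (n - 1 - k) + 1) choose r) * run_comps r k))
      * (c * fact (n - k - r) / fact (2 * (n - 1) - k)))"
    by (rule mult_left_mono) simp
  also have "\<dots> = (real n)\<^sup>2 * (c * term_bound n k r)"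
    using k by (simp add: term_bound_def mult_ac)
  finally show ?thesis using True by simp
next
  case False
  then have "describing n u = {}" if "u \<in> words n k r" for u using A[OF that] by blast
  then show ?thesis using False by simp
qed

text \<open>Adding the two estimates allows each to be summed over all \<open>k\<close>. Outside the
  geometric range \<open>k\<close> is positive, so r = 0 contributes nothing.\<close>

lemma term_bound_le_sum:
  assumes k: "k < n" and r: "k + r \<le> n" and n: "n \<ge> 32"
  shows "term_bound n k r \<le> real (run_comps r k) * 4 ^ r / fact r * (16 / 17) ^ k +
    1 / n * ((if r = 0 then 0 else 64 * 64 ^ (r - 1) / fact (r - 1)) * (1 / 2) ^ (n - k))"
proof (cases "n < 8 * (n - k)")
  case True
  have "0 \<le> 1 / n * ((if r = 0 then 0 else 64 * 64 ^ (r - 1) / fact (r - 1)) * (1 / 2 :: real) ^ (n - k))"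
    by simp
  with term_bound_le_geometric[OF k r True n] show ?thesis by linarith
next
  case False
  then have "k \<noteq> 0" using n by auto
  show ?thesis
  proof (cases r)
    case 0
    then show ?thesis using \<open>k \<noteq> 0\<close> by (simp add: term_bound_def)
  next
    case (Suc r')
    have "0 \<le> real (run_comps r k) * 4 ^ r / fact r * (16 / 17 :: real) ^ k" by simp
    with term_bound_le_small[of k n r'] k r False Suc show ?thesis by simp
  qed
qed

text \<open>The summand \<open>64 * exp 64 * 2 / n\<close> accounts for nearly equal paths (\<open>8 * (n - k) \<le> n\<close>); the
  majorant for the other \<open>k\<close> uses \<open>16 / 17 = (288 / 289) * (17 / 18)\<close>.\<close>

lemma tail_le:
  assumes n: "n \<ge> 32"
  shows "(\<Sum>k=K..<n. \<Sum>r\<le>k. if k + r \<le> n then term_bound n k r else 0)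
    \<le> (288 / 289) ^ K * exp (4 * (17 / 18 + (17 / 18) / (1 - 17 / 18))) + 64 * exp 64 * 2 / n"
proof -
  let ?a = "\<lambda>k r. real (run_comps r k) * 4 ^ r / fact r * (16 / 17) ^ k"
  let ?b = "\<lambda>r. if r = 0 then 0 else 64 * 64 ^ (r - 1) / fact (r - 1) :: real"
  have "(\<Sum>k=K..<n. \<Sum>r\<le>k. if k + r \<le> n then term_bound n k r else 0)
    \<le> (\<Sum>k=K..<n. \<Sum>r\<le>k. ?a k r + 1 / n * (?b r * (1 / 2) ^ (n - k)))"
  proof (intro sum_mono)
    fix k r assume k: "k \<in> {K..<n}"
    have "0 \<le> ?a k r + 1 / n * (?b r * (1 / 2) ^ (n - k))" by simp
    then show "(if k + r \<le> n then term_bound n k r else 0) \<le> ?a k r + 1 / n * (?b r * (1 / 2) ^ (n - k))"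
      using term_bound_le_sum[of k n r] k n by auto
  qed
  also have "\<dots> = (\<Sum>k=K..<n. \<Sum>r\<le>k. ?a k r) + (\<Sum>k=K..<n. \<Sum>r\<le>k. 1 / n * (?b r * (1 / 2) ^ (n - k)))"
    by (simp only: sum.distrib)
  also have "(\<Sum>k=K..<n. \<Sum>r\<le>k. ?a k r) \<le> (288 / 289) ^ K * exp (4 * (17 / 18 + (17 / 18) / (1 - 17 / 18)))"
  proof -
    have "(\<Sum>k=K..<n. \<Sum>r\<le>k. ?a k r) \<le>
      (\<Sum>k=K..<n. \<Sum>r\<le>k. (288 / 289) ^ K * (real (run_comps r k) * 4 ^ r / fact r * (17 / 18) ^ k))"
    proof (intro sum_mono)
      fix k r assume k: "k \<in> {K..<n}"
      have "(16 / 17 :: real) ^ k = (288 / 289) ^ k * (17 / 18) ^ k"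
        by (simp flip: power_mult_distrib)
      also have "\<dots> \<le> (288 / 289) ^ K * (17 / 18) ^ k"
        using k by (intro mult_right_mono power_decreasing) auto
      finally have "?a k r \<le> real (run_comps r k) * 4 ^ r / fact r * ((288 / 289) ^ K * (17 / 18) ^ k)"
        by (intro mult_left_mono) auto
      then show "?a k r \<le> (288 / 289) ^ K * (real (run_comps r k) * 4 ^ r / fact r * (17 / 18) ^ k)"
        by (simp only: mult_ac)
    qed
    also have "\<dots> = (288 / 289) ^ K * (\<Sum>k=K..<n. \<Sum>r\<le>k. real (run_comps r k) * 4 ^ r / fact r * (17 / 18) ^ k)"
      by (simp only: sum_distrib_left)
    also have "\<dots> \<le> (288 / 289) ^ K * (\<Sum>k\<le>n. \<Sum>r\<le>k. real (run_comps r k) * 4 ^ r / fact r * (17 / 18) ^ k)"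
      by (intro mult_left_mono sum_mono2) (auto intro!: sum_nonneg)
    also have "\<dots> \<le> (288 / 289) ^ K * exp (4 * (17 / 18 + (17 / 18) / (1 - 17 / 18)))"
      by (intro mult_left_mono run_comps_sum_le) auto
    finally show ?thesis .
  qed
  also have "(\<Sum>k=K..<n. \<Sum>r\<le>k. 1 / n * (?b r * (1 / 2) ^ (n - k))) \<le> 64 * exp 64 * 2 / n"
  proof -
    have b: "(\<Sum>r\<le>k. ?b r) \<le> 64 * exp 64" for k
    proof -
      have "(\<Sum>r\<le>k. ?b r) = 64 * (\<Sum>i<k. 64 ^ i /\<^sub>R fact i)"
        by (simp add: sum.atMost_shift sum_distrib_left divide_inverse mult_ac)
      also have "\<dots> \<le> 64 * exp 64"
        unfolding exp_def by (intro mult_left_mono sum_le_suminf summable_exp_generic) auto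
      finally show ?thesis .
    qed
    have "(\<Sum>k=K..<n. \<Sum>r\<le>k. 1 / n * (?b r * (1 / 2) ^ (n - k))) = (\<Sum>k=K..<n. (1 / n * (1 / 2) ^ (n - k)) * (\<Sum>r\<le>k. ?b r))"
      unfolding sum_distrib_left by (intro sum.cong refl) (simp only: mult_ac)
    also have "\<dots> \<le> (\<Sum>k=K..<n. (1 / n * (1 / 2) ^ (n - k)) * (64 * exp 64))"
      by (intro sum_mono mult_left_mono b) auto
    also have "\<dots> \<le> (\<Sum>k<n. (1 / n * (1 / 2) ^ (n - k)) * (64 * exp 64))"
      by (intro sum_mono2) auto
    also have "\<dots> = (\<Sum>k<n. (1 / 2) ^ (n - k)) * (64 * exp 64) / n"
      unfolding sum_distrib_right sum_divide_distrib by (intro sum.cong refl) simp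
    also have "(\<Sum>k<n. (1 / 2 :: real) ^ (n - k)) = (\<Sum>k<n. (1 / 2) ^ Suc (n - Suc k))"
      by (intro sum.cong refl) (simp add: Suc_diff_Suc del: power_Suc)
    also have "\<dots> = (\<Sum>k<n. (1 / 2) ^ Suc k)"
      by (rule sum.nat_diff_reindex)
    also have "\<dots> \<le> 2"
      by (simp add: sum_gp_strict flip: sum_divide_distrib, rule order.trans[of _ 0]) auto
    finally show ?thesis using n by (simp add: divide_right_mono mult_right_mono mult_ac)
  qed
  finally show ?thesis by simp
qed

lemma eventually_second_moment_le:
  assumes \<delta>: "\<delta> > (0 :: real)"
  shows "\<forall>\<^sub>F n in sequentially.
    fact n * (\<Sum>k<n. \<Sum>r\<le>k. \<Sum>u\<in>words n k r. card (describing n u) / fact (2 * (n - 1) - k)) \<le> (exp 1 + \<delta>) * (real n)\<^sup>2"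
proof -
  \<comment> \<open>Four errors of \<delta> / 4 are allowed: \<open>\<epsilon> * exp 3\<close> from
    the fraction \<theta>, the convergence of the terms below \<open>K\<close>, the geometric tail
    from \<open>K\<close> on, and the O(1 / n) near the diagonal.\<close>
  define \<epsilon> where "\<epsilon> = \<delta> / (4 * exp 3)"
  define \<theta> where "\<theta> = exp (- 2) + \<epsilon>"
  define E :: real where "E = exp (4 * (17 / 18 + (17 / 18) / (1 - 17 / 18)))"
  have \<epsilon>: "\<epsilon> > 0" and \<theta>: "\<theta> > 0" using \<delta> by (auto simp: \<epsilon>_def \<theta>_def intro!: add_pos_pos)
  have "(\<lambda>K. (288 / 289) ^ K * E) \<longlonglongrightarrow> 0 * E" by (intro tendsto_intros LIMSEQ_power_zero) simp
  then have "\<forall>\<^sub>F K in sequentially. (288 / 289) ^ K * E < \<delta> / 4" using \<delta> by (intro order_tendstoD(2)) auto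
  then obtain K where K: "(288 / 289) ^ K * E < \<delta> / 4" by (auto simp: eventually_sequentially)
  have "\<exists>g. \<forall>k. \<forall>M\<ge>g k. \<forall>V W. almost_paths (2 * k + 1) M V W \<longrightarrow>
     real (card {\<sigma> \<in> bijections V W. bonds V \<sigma> = {}}) \<le> (exp (- 2) + \<epsilon>) * fact M"
    by (intro choice allI bondless_le \<epsilon>)
  then obtain g where g0: "\<forall>k. \<forall>M\<ge>g k. \<forall>V W. almost_paths (2 * k + 1) M V W \<longrightarrow>
     real (card {\<sigma> \<in> bijections V W. bonds V \<sigma> = {}}) \<le> (exp (- 2) + \<epsilon>) * fact M" ..
  have g: "real (card {\<sigma> \<in> bijections V W. bonds V \<sigma> = {}}) \<le> \<theta> * fact M"
    if "M \<ge> g k" "almost_paths (2 * k + 1) M V W" for k M V W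
    using g0[rule_format, OF that] by (simp only: \<theta>_def)
  let ?T = "\<lambda>n k r. if k + r \<le> n then term_bound n k r else 0"
  have lim: "(\<lambda>n. \<Sum>k<K. \<Sum>r\<le>k. term_bound n k r) \<longlonglongrightarrow> (\<Sum>k<K. \<Sum>r\<le>k. real (run_comps r k) * 2 ^ r / fact r * (1 / 2) ^ k)"
    by (intro tendsto_sum term_bound_tendsto)
  have "(\<Sum>k<K. \<Sum>r\<le>k. real (run_comps r k) * 2 ^ r / fact r * (1 / 2) ^ k) \<le>
      (\<Sum>k\<le>K. \<Sum>r\<le>k. real (run_comps r k) * 2 ^ r / fact r * (1 / 2) ^ k)"
    by (intro sum_mono2) (auto intro!: sum_nonneg)
  also have "\<dots> \<le> exp (2 * (1 / 2 + (1 / 2) / (1 - 1 / 2)))" by (intro run_comps_sum_le) auto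
  also have "\<dots> = exp 3" by simp
  also have "\<dots> < exp 3 + \<delta> / (4 * \<theta>)" using \<delta> \<theta> by simp
  finally have "\<forall>\<^sub>F n in sequentially. (\<Sum>k<K. \<Sum>r\<le>k. term_bound n k r) < exp 3 + \<delta> / (4 * \<theta>)"
    by (intro order_tendstoD(2)[OF lim])
  moreover have "\<forall>\<^sub>F n in sequentially. 64 * exp 64 * 2 / real n < \<delta> / 4"
  proof -
    have "(\<lambda>n. 64 * exp 64 * 2 / real n) \<longlonglongrightarrow> 0" by (rule lim_const_over_n)
    then show ?thesis using \<delta> by (intro order_tendstoD(2)) auto
  qed
  \<comment> \<open>For k < K and r \<le> k at most \<open>2 * K\<close> positions are fixed, so n -
    k - r still exceeds the threshold \<open>g k\<close>; the 32 is for
    \<open>tail_le\<close>.\<close>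
  moreover have "\<forall>\<^sub>F n in sequentially. n \<ge> 32 + 2 * K + (\<Sum>k<K. g k)" by (rule eventually_ge_at_top)
  ultimately show ?thesis
  proof eventually_elim
    case (elim n)
    then have n: "n \<ge> 32" "K \<le> n" "n > 0" by auto
    define c where "c k = (if k < K then \<theta> else 1)" for k
    have c: "c k \<ge> 0" for k using \<theta> by (simp add: c_def)
    have A: "k + r \<le> n \<and> real (card (describing n u)) \<le> c k * fact (n - k - r)"
      if u: "u \<in> words n k r" "describing n u \<noteq> {}" and k: "k < n" "r \<le> k" for k r u
    proof -
      obtain \<tau> where \<tau>: "\<tau> \<in> bijections {..<n} {..<n}" "describes n \<tau> u"
        using u by (auto simp: describing_def)
      have kr: "shared_steps u = k" "runs u = r" using u by (auto simp: words_def)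
      note * = card_described_le[OF \<tau> n(3), unfolded kr]
      obtain V W where VW: "almost_paths (2 * k + 1) (n - k - r) V W"
          "card (describing n u) \<le> card {\<sigma> \<in> bijections V W. bonds V \<sigma> = {}}"
        using *(3) unfolding describing_def by blast
      have "real (card {\<sigma> \<in> bijections V W. bonds V \<sigma> = {}}) \<le> c k * fact (n - k - r)"
      proof (cases "k < K")
        case True
        have "g k \<le> (\<Sum>k<K. g k)" using True by (intro member_le_sum) auto
        then have "g k \<le> n - k - r" using elim True k by linarith
        then show ?thesis using g[OF _ VW(1)] True by (simp add: c_def)
      next
        case False
        have fin: "finite V" "finite W" "card V = card W" "card V = n - k - r"
          using VW(1) by (auto simp: almost_paths_def)
        have "card {\<sigma> \<in> bijections V W. bonds V \<sigma> = {}} \<le> card (bijections V W)"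
          using finite_bijections[OF fin(1,2)] by (intro card_mono) auto
        also have "\<dots> \<le> fact (n - k - r)" using card_bijections_le[OF fin(1-3)] fin(4) by simp
        finally have "real (card {\<sigma> \<in> bijections V W. bonds V \<sigma> = {}}) \<le> real (fact (n - k - r))"
          by (rule of_nat_mono)
        then show ?thesis using False by (simp add: c_def)
      qed
      then show ?thesis using VW(2) *(1) by linarith
    qed
    have "fact n * (\<Sum>k<n. \<Sum>r\<le>k. \<Sum>u\<in>words n k r. card (describing n u) / fact (2 * (n - 1) - k))
      = (\<Sum>k<n. \<Sum>r\<le>k. fact n * (\<Sum>u\<in>words n k r. card (describing n u) / fact (2 * (n - 1) - k)))"
      by (simp only: sum_distrib_left)
    also have "\<dots> \<le> (\<Sum>k<n. \<Sum>r\<le>k. (real n)\<^sup>2 * (c k * ?T n k r))"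
      by (intro sum_mono words_sum_le c A) auto
    also have "\<dots> = (real n)\<^sup>2 * (\<Sum>k<n. c k * (\<Sum>r\<le>k. ?T n k r))"
      by (simp only: sum_distrib_left)
    also have "(\<Sum>k<n. c k * (\<Sum>r\<le>k. ?T n k r)) =
        (\<Sum>k<K. c k * (\<Sum>r\<le>k. ?T n k r)) + (\<Sum>k=K..<n. c k * (\<Sum>r\<le>k. ?T n k r))"
      using n(2) by (simp add: lessThan_atLeast0 sum.atLeastLessThan_concat)
    also have "(\<Sum>k<K. c k * (\<Sum>r\<le>k. ?T n k r)) = \<theta> * (\<Sum>k<K. \<Sum>r\<le>k. ?T n k r)"
      unfolding sum_distrib_left[of \<theta>] by (intro sum.cong) (auto simp: c_def sum_distrib_left)
    also have "(\<Sum>k=K..<n. c k * (\<Sum>r\<le>k. ?T n k r)) = (\<Sum>k=K..<n. \<Sum>r\<le>k. ?T n k r)"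
      by (intro sum.cong) (auto simp: c_def)
    finally have le: "fact n * (\<Sum>k<n. \<Sum>r\<le>k. \<Sum>u\<in>words n k r. card (describing n u) / fact (2 * (n - 1) - k))
      \<le> (real n)\<^sup>2 * (\<theta> * (\<Sum>k<K. \<Sum>r\<le>k. ?T n k r) + (\<Sum>k=K..<n. \<Sum>r\<le>k. ?T n k r))" .
    have "(\<Sum>k<K. \<Sum>r\<le>k. ?T n k r) \<le> (\<Sum>k<K. \<Sum>r\<le>k. term_bound n k r)"
      by (intro sum_mono) (simp add: term_bound_nonneg)
    then have "\<theta> * (\<Sum>k<K. \<Sum>r\<le>k. ?T n k r) \<le> \<theta> * (exp 3 + \<delta> / (4 * \<theta>))"
      using elim(1) \<theta> by (intro mult_left_mono) auto
    also have "\<dots> = exp (- 2) * exp 3 + \<delta> / 4 + \<delta> / 4"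
      using \<theta> by (simp add: distrib_left) (simp add: \<theta>_def \<epsilon>_def distrib_right)
    also have "exp (- 2) * exp 3 = (exp 1 :: real)" by (simp flip: exp_add)
    finally have main: "\<theta> * (\<Sum>k<K. \<Sum>r\<le>k. ?T n k r) \<le> exp 1 + \<delta> / 4 + \<delta> / 4" .
    have "(\<Sum>k=K..<n. \<Sum>r\<le>k. ?T n k r) \<le> \<delta> / 4 + \<delta> / 4"
      using tail_le[OF n(1), of K] K elim(2) unfolding E_def by linarith
    with main have "\<theta> * (\<Sum>k<K. \<Sum>r\<le>k. ?T n k r) + (\<Sum>k=K..<n. \<Sum>r\<le>k. ?T n k r) \<le> exp 1 + \<delta>" by linarith
    then have "(real n)\<^sup>2 * (\<theta> * (\<Sum>k<K. \<Sum>r\<le>k. ?T n k r) + (\<Sum>k=K..<n. \<Sum>r\<le>k. ?T n k r)) \<le> (real n)\<^sup>2 * (exp 1 + \<delta>)"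
      by (intro mult_left_mono) auto
    with le show ?case by (simp add: mult.commute)
  qed
qed

theorem theorem2:
  shows "\<exists>\<epsilon> \<in> o(\<lambda>_. 1 :: real). \<forall>n :: nat.
    measure_pmf.prob (random_edge_ordering n)
      {f. \<exists>p. increasing_path n f p \<and> hamiltonian n p} \<ge> 1 / exp 1 + \<epsilon> n"
proof -
  define P where "P n = measure_pmf.prob (random_edge_ordering n)
    {f. \<exists>p. increasing_path n f p \<and> hamiltonian n p}" for n
  \<comment> \<open>Capping at 0 makes the inequality true for every \<open>n\<close>, and
    convergence to 0 then needs only a lower bound on \<open>P n\<close>.\<close>
  define \<epsilon> where "\<epsilon> n = min 0 (P n - 1 / exp 1)" for n
  have "\<epsilon> \<longlonglongrightarrow> 0"
  proof (rule tendstoI)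
    fix e :: real assume e: "e > 0"
    then have "e / 2 > 0" by simp
    from eventually_second_moment_le[OF this] eventually_gt_at_top[of 0]
    have "\<forall>\<^sub>F n in sequentially. 1 / (exp 1 + e / 2) \<le> P n"
      unfolding P_def by eventually_elim (rule prob_ge)
    then show "\<forall>\<^sub>F n in sequentially. dist (\<epsilon> n) 0 < e"
    proof eventually_elim
      case (elim n)
      have "1 / a - 1 / (a + e / 2) \<le> e / 2" if a: "a \<ge> 1" for a :: real
      proof -
        have "1 / a - 1 / (a + e / 2) = (e / 2) / (a * (a + e / 2))"
          using a e by (simp add: diff_frac_eq)
        also have "\<dots> \<le> (e / 2) / (1 * 1)"
          using a e by (intro divide_left_mono mult_mono) auto
        finally show ?thesis by simp
      qed
      from this[of "exp 1"] have "1 / exp 1 - 1 / (exp 1 + e / 2) \<le> e / 2" by simp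
      then show ?case using elim e by (simp add: \<epsilon>_def dist_real_def)
    qed
  qed
  then have "\<epsilon> \<in> o(\<lambda>_. 1)" by (intro smalloI_tendsto) auto
  moreover have "1 / exp 1 + \<epsilon> n \<le> P n" for n by (simp add: \<epsilon>_def)
  ultimately show ?thesis unfolding P_def by blast
qed

end
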